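(* Let $n\ge2$ and let $M\in\mathbb{C}^{n\times n}$ be complex symmetric ($M^T=M$) and sectorial with phases $\phi(M)=(\mu_1,\ldots,\mu_n)$, where \[ \pi>\mu_1\ge\mu_2\ge\cdots\ge\mu_n>-\pi/2,\qquad \mu_1-\mu_n<\pi . \] Then the following hold. (i) If $\mu_1+\mu_2\le\pi$, then there is no $\Delta\in\mathbb{R}^{n\times n}$ with $\Delta+\Delta^T\succ0$ and $\det(I+M\Delta)=0$. Thus $\theta_{\mathbb{R}}(M)=+\infty$. (ii) If $\mu_1+\mu_2>\pi$, then \[ \theta_{\mathbb{R}}(M)=\arccos\!\left(-\frac{\cos((\mu_1+\mu_2)/2)}{\cos((\mu_1-\mu_2)/2)}\right). \]
   Context: For a square matrix $A$, $\operatorname{H}(A)=\tfrac12(A+A^* )$ is its Hermitian part, and $\succ0$ means positive definite. A matrix $A\in\mathbb{C}^{n\times n}$ is *sectorial* if $0$ is not in its numerical range $\{x^*Ax: x\in\mathbb{C}^n,\|x\|=1\}$. A sectorial $A$ can be written as $A=T^*\operatorname{diag}(e^{\mathrm{i}\phi_1},\ldots,e^{\mathrm{i}\phi_n})T$ with $T\in\mathbb{C}^{n\times n}$ invertible and $\phi_1\ge\cdots\ge\phi_n$ in an interval of length strictly less than $\pi$; once the interval is chosen these numbers are uniquely determined and are called the *phases* $\phi(A)=(\phi_1(A),\ldots,\phi_n(A))$. Thus "$M$ is sectorial with phases $(\mu_1,\ldots,\mu_n)$" means $M=T^*\operatorname{diag}(e^{\mathrm{i}\mu_1},\ldots,e^{\mathrm{i}\mu_n})T$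 for some invertible complex $T$, with $\mu_1-\mu_n<\pi$. A real $\Delta$ with $\operatorname{H}(\Delta)\succ0$ is sectorial and its phases are taken in $(-\pi/2,\pi/2)$; $\phi_1(\Delta)=\max_{x\in\mathbb{C}^n,\|x\|=1}\angle(x^*\Delta x)$ is its largest phase. The real angular stability radius of $M\in\mathbb{C}^{n\times n}$ is \[ \theta_{\mathbb{R}}(M):=\inf\{\phi_1(\Delta):\Delta\in\mathbb{R}^{n\times n},\ \operatorname{H}(\Delta)\succ0,\ \det(I+M\Delta)=0\}, \] with $\inf\emptyset=+\infty$. *)

theory Defs
  imports
    Complex_Main
    "HOL-Library.Extended_Real"
    "Jordan_Normal_Form.Determinant"
    "Jordan_Normal_Form.Schur_Decomposition"
begin

text \<open>\<^const>\<open>mat_adjoint\<close> is the conjugate transpose; over the reals it is the transpose.\<close>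

definition hermitian_part :: "'a :: conjugatable_ordered_field mat \<Rightarrow> 'a mat"
  where "hermitian_part A = (1 / 2) \<cdot>\<^sub>m (A + mat_adjoint A)"

text \<open>Here \<open>(A *\<^sub>v x) \<bullet>c x\<close> is \<open>x\<^sup>* A x\<close>. Over the complex numbers, \<open>0 < z\<close> means that
  \<open>z\<close> is real and positive.\<close>

definition positive_definite :: "'a :: conjugatable_ordered_field mat \<Rightarrow> bool"
  where "positive_definite A \<longleftrightarrow>
    square_mat A \<and> mat_adjoint A = A \<and>
    (\<forall>x \<in> carrier_vec (dim_row A). x \<noteq> 0\<^sub>v (dim_row A) \<longrightarrow> 0 < (A *\<^sub>v x) \<bullet>c x)"

text \<open>The phases are numbered from 1 as \<open>\<phi> 1 \<ge> \<dots> \<ge> \<phi> n\<close>, whereas matrix indices start at 0;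
  values of \<open>\<phi>\<close> outside \<open>{1..n}\<close> are irrelevant. The phases are determined only up to a
  common multiple of \<open>2 * pi\<close>, so users of this predicate have to fix an interval for them.\<close>

definition sectorial_with_phases :: "nat \<Rightarrow> complex mat \<Rightarrow> (nat \<Rightarrow> real) \<Rightarrow> bool"
  where "sectorial_with_phases n A \<phi> \<longleftrightarrow>
    antimono_on {1..n} \<phi> \<and> \<phi> 1 - \<phi> n < pi \<and>
    (\<exists>T \<in> carrier_mat n n. invertible_mat T \<and>
       A = mat_adjoint T * mat_diag n (\<lambda>i. cis (\<phi> (Suc i))) * T)"

abbreviation complex_mat :: "real mat \<Rightarrow> complex mat"
  where "complex_mat \<equiv> map_mat complex_of_real"

text \<open>Every real \<open>\<Delta>\<close> with positive definite Hermitian part has exactly one tuple of phases in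
  the open interval from \<open>- pi / 2\<close> to \<open>pi / 2\<close>, so quantifying over \<open>\<phi>\<close> only names
  the largest phase \<open>\<phi> 1\<close> of \<open>\<Delta>\<close>. The infimum of the empty set in \<^typ>\<open>ereal\<close> is \<open>\<infinity>\<close>.\<close>

definition real_angular_stability_radius :: "nat \<Rightarrow> complex mat \<Rightarrow> ereal"
  where "real_angular_stability_radius n M =
    Inf {ereal (\<phi> 1) | \<phi> \<Delta>.
      \<Delta> \<in> carrier_mat n n \<and> positive_definite (hermitian_part \<Delta>) \<and>
      sectorial_with_phases n (complex_mat \<Delta>) \<phi> \<and>
      (\<forall>i \<in> {1..n}. \<phi> i \<in> {- pi / 2 <..< pi / 2}) \<and>
      det (1\<^sub>m n + M * complex_mat \<Delta>) = 0}"

end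

theory Submission
  imports Defs
begin

text \<open>
  Since \<open>M\<close> is complex symmetric and sectorial, a rotation of it has real symmetric real and imaginary
  parts, the first positive definite, so that \<open>M = R\<^sup>T D R\<close> with \<open>R\<close> real and \<open>D\<close> the diagonal matrix of
  the phases. If \<open>(I + M \<Delta>) z = 0\<close>, then with \<open>w = R \<Delta> z\<close> the numbers \<open>p = z\<^sup>* \<Delta> z\<close> and \<open>q = z\<^sup>T \<Delta> z\<close> are
  minus the sums of \<open>cis (- \<mu>\<^sub>k) \<bar>w\<^sub>k\<bar>\<^sup>2\<close> and of \<open>cis \<mu>\<^sub>k w\<^sub>k\<^sup>2\<close>, whence \<open>\<bar>q\<bar>\<close> is at least
  \<open>\<bar>w\<^sub>1\<bar>\<^sup>2\<close> minus the sum of the other \<open>\<bar>w\<^sub>k\<bar>\<^sup>2\<close>. As \<open>\<Delta>\<close> is real, testing its numerical range on the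
  span of \<open>z\<close> and its conjugate gives \<open>\<bar>q\<bar> \<le> Re p\<close>, and
  \<open>(Im p)\<^sup>2 + \<tau>\<^sup>2 \<bar>q\<bar>\<^sup>2 \<le> \<tau>\<^sup>2 (Re p)\<^sup>2\<close> with \<open>\<tau>\<close> the tangent of the largest phase of \<open>\<Delta>\<close>. The first
  inequality is contradictory if \<open>\<mu>\<^sub>1 + \<mu>\<^sub>2 \<le> \<pi>\<close>; otherwise the second bounds \<open>\<tau>\<close> from below, and the
  bound is attained when \<open>R \<Delta> R\<^sup>T\<close> is a plane rotation in the first two coordinates.
\<close>

section \<open>Diagonalization by real congruence\<close>

text \<open>Complete \<open>v\<close> to a basis that starts with \<open>v\<close>; Gram-Schmidt
  keeps the first vector, and normalization makes the columns orthonormal. The scalar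
  \<open>k\<close> may stay unspecified because an eigenvector matters only up to scaling.\<close>

lemma orthogonal_matrix_with_first_column:
  fixes v :: "real vec"
  assumes v: "v \<in> carrier_vec n" and v0: "v \<noteq> 0\<^sub>v n" and n: "n \<noteq> 0"
  obtains U k where "U \<in> carrier_mat n n" "transpose_mat U * U = 1\<^sub>m n" "col U 0 = k \<cdot>\<^sub>v v"
proof -
  interpret cof_vec_space n "TYPE(real)" .
  define b where "b = basis_completion v"
  define ws where "ws = gram_schmidt n b"
  from basis_completion[OF v v0, folded b_def]
  have dist_b: "distinct b" and indep: "\<not> lin_dep (set b)" and b: "set b \<subseteq> carrier_vec n"
    and hdb: "hd b = v" and len_b: "length b = n" by auto
  from hdb len_b n obtain vs where bv: "b = v # vs" by (cases b, auto)
  from gram_schmidt_result[OF b dist_b indep refl, folded ws_def]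
  have ws: "set ws \<subseteq> carrier_vec n" "corthogonal ws" "length ws = n"
    by (auto simp: len_b)
  from gram_schmidt_hd[OF v, of vs, folded bv] have hdws: "hd ws = v" unfolding ws_def .
  define f where "f i = 1 / sqrt (ws ! i \<bullet> ws ! i)" for i
  define U where "U = mat_of_cols n (map (\<lambda>i. f i \<cdot>\<^sub>v (ws ! i)) [0..<n])"
  have U: "U \<in> carrier_mat n n" unfolding U_def by auto
  have wsi: "ws ! i \<in> carrier_vec n" if "i < n" for i using ws that by auto
  have col: "col U i = f i \<cdot>\<^sub>v (ws ! i)" if "i < n" for i
    unfolding U_def using that wsi by (subst col_mat_of_cols) auto
  have orth: "ws ! i \<bullet> ws ! j = 0 \<longleftrightarrow> i \<noteq> j" if "i < n" "j < n" for i j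
    using corthogonalD[OF ws(2), of i j] ws(3) that by simp
  have "transpose_mat U * U = 1\<^sub>m n"
  proof (rule eq_matI)
    fix i j assume ij: "i < dim_row (1\<^sub>m n)" "j < dim_col (1\<^sub>m n)"
    hence [simp]: "i < n" "j < n" by auto
    have "(transpose_mat U * U) $$ (i,j) = col U i \<bullet> col U j"
      using U by auto
    also have "\<dots> = f i * f j * (ws ! i \<bullet> ws ! j)"
      using wsi[of i] wsi[of j] by (simp add: col)
    also have "\<dots> = 1\<^sub>m n $$ (i,j)"
    proof (cases "i = j")
      case True
      have "ws ! i \<bullet> ws ! i \<ge> 0" using conjugate_square_ge_0_vec[of "ws ! i"] by simp
      then show ?thesis using True orth[of i i] by (simp add: f_def)
    next
      case False
      then show ?thesis using orth[of i j] by simp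
    qed
    finally show "(transpose_mat U * U) $$ (i,j) = 1\<^sub>m n $$ (i,j)" .
  qed (use U in auto)
  moreover have "col U 0 = f 0 \<cdot>\<^sub>v v"
    using col[of 0] n hdws ws(3) by (cases ws) auto
  ultimately show thesis using that U by blast
qed

text \<open>Deflation along the list of roots: an eigenvector for the first root becomes the first
  column of an orthogonal matrix, and by symmetry the conjugated matrix splits into that eigenvalue
  and a smaller symmetric block. Taking the roots as a list lets later uses prescribe the order of
  the diagonal.\<close>

lemma real_symmetric_diagonalization:
  fixes A :: "real mat"
  assumes "A \<in> carrier_mat n n" "transpose_mat A = A" "char_poly A = (\<Prod>e\<leftarrow>es. [:- e, 1:])"
  shows "\<exists>U \<in> carrier_mat n n. transpose_mat U * U = 1\<^sub>m n \<and>
    A = transpose_mat U * mat_diag n (\<lambda>i. es ! i) * U"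
  using assms
proof (induction es arbitrary: n A)
  case (Nil n A)
  from Nil degree_monic_char_poly[of A n] have "n = 0" by auto
  with Nil show ?case by (intro bexI[of _ "1\<^sub>m 0"]) auto
next
  case (Cons e es n A)
  note A = Cons.prems(1)
  define m where "m = n - 1"
  have cp: "char_poly A = [:- e, 1:] * (\<Prod>e\<leftarrow>es. [:- e, 1:])" using Cons.prems(3) by simp
  have mon: "monic (\<Prod>e\<leftarrow>es. [:- e, 1:])" by (rule monic_prod_list, auto)
  have "degree (char_poly A) = Suc (degree (\<Prod>e\<leftarrow>es. [:- e, 1:]))" unfolding cp
    by (subst degree_mult_eq, insert mon, auto)
  with degree_monic_char_poly[OF A] have n: "n \<noteq> 0" by auto
  hence nm: "n = 1 + m" by (simp add: m_def)
  have "eigenvalue A e" unfolding eigenvalue_root_char_poly[OF A] cp by simp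
  then obtain v where v: "v \<in> carrier_vec n" "v \<noteq> 0\<^sub>v n" "A *\<^sub>v v = e \<cdot>\<^sub>v v"
    unfolding eigenvalue_def eigenvector_def using A by auto
  obtain V k where V: "V \<in> carrier_mat n n" and VV: "transpose_mat V * V = 1\<^sub>m n"
    and colV: "col V 0 = k \<cdot>\<^sub>v v"
    using orthogonal_matrix_with_first_column[OF v(1,2) n] .
  have VtV: "V * transpose_mat V = 1\<^sub>m n"
    by (rule mat_mult_left_right_inverse[OF _ V VV]) (use V in auto)
  define B where "B = transpose_mat V * A * V"
  have B: "B \<in> carrier_mat n n" using V A by (auto simp: B_def)
  have Bt: "transpose_mat B = B"
    unfolding B_def using V A Cons.prems(2)
    by (simp add: transpose_mult[of _ n n _ n] assoc_mult_mat[of _ n n _ n _ n])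
  have A_B: "A = V * B * transpose_mat V"
  proof -
    have "V * B * transpose_mat V = (V * transpose_mat V) * A * (V * transpose_mat V)"
      unfolding B_def using V A by (simp add: assoc_mult_mat[of _ n n _ n _ n])
    thus ?thesis using VtV A by simp
  qed
  have sim: "similar_mat B A"
    unfolding similar_mat_def
    by (intro exI, rule similar_mat_witI[of "transpose_mat V" V n B A])
      (use V A VV VtV B in \<open>auto simp: B_def\<close>)
  \<comment> \<open>The first column of \<open>V\<close> is a multiple of the eigenvector, so
    orthonormality of the columns leaves only the corner entry \<open>e\<close>.\<close>
  have B0: "B $$ (i, 0) = (if i = 0 then e else 0)" if "i < n" for i
  proof -
    have "B $$ (i,0) = col V i \<bullet> (A *\<^sub>v col V 0)"
      unfolding B_def using V A that n
      by (subst assoc_mult_mat[of _ n n _ n _ n]) (auto simp: mult_mat_vec_def intro!: arg_cong[of _ _ "\<lambda>x. _ \<bullet> x"])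
    also have "A *\<^sub>v col V 0 = e \<cdot>\<^sub>v col V 0"
      unfolding colV using A v by (simp add: mult_mat_vec smult_smult_assoc ac_simps)
    also have "col V i \<bullet> (e \<cdot>\<^sub>v col V 0) = e * (transpose_mat V * V) $$ (i,0)"
      using V that n by auto
    finally show ?thesis using that n by (simp add: VV)
  qed
  obtain A1 A2 A0 A3 where split: "split_block B 1 1 = (A1,A2,A0,A3)"
    by (cases "split_block B 1 1", auto)
  have "dim_row B = 1 + m" "dim_col B = 1 + m" using B nm by auto
  from split_block[OF split this]
  have A3: "A3 \<in> carrier_mat m m" and B4: "B = four_block_mat A1 A2 A0 A3" by auto
  define E where "E = mat 1 1 (\<lambda>_. e)"
  have E: "E \<in> carrier_mat 1 1" by (auto simp: E_def)
  have sym: "B $$ (i,j) = B $$ (j,i)" if "i < n" "j < n" for i j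
    using arg_cong[OF Bt, of "\<lambda>X. X $$ (j,i)"] B that by auto
  \<comment> \<open>Symmetry of \<open>B\<close> carries the zeros of the first column over to the
    first row.\<close>
  have A1: "A1 = E" and A2: "A2 = 0\<^sub>m 1 m" and A0: "A0 = 0\<^sub>m m 1"
    using split B B0 sym[of 0] nm by (auto simp: split_block_def Let_def E_def)
  have A3t: "transpose_mat A3 = A3"
    using split B sym nm by (auto simp: split_block_def Let_def intro!: eq_matI)
  have "char_poly B = char_poly E * char_poly A3"
    unfolding B4 A1 A0 A2 by (rule char_poly_four_block_zeros_col[OF E _ A3]) auto
  moreover have "char_poly E = [:- e, 1:]"
    by (simp add: E_def char_poly_defs det_def sign_def)
  ultimately have "char_poly A3 = (\<Prod>e\<leftarrow>es. [:- e, 1:])"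
    using cp char_poly_similar[OF sim] by (metis mult_cancel_left pCons_eq_0_iff zero_neq_one)
  from Cons.IH[OF A3 A3t this] obtain W where W: "W \<in> carrier_mat m m"
    and WW: "transpose_mat W * W = 1\<^sub>m m"
    and A3W: "A3 = transpose_mat W * mat_diag m (\<lambda>i. es ! i) * W" by auto
  define Dm where "Dm = mat_diag m (\<lambda>i. es ! i)"
  have Dm: "Dm \<in> carrier_mat m m" by (simp add: Dm_def)
  note A3W = A3W[folded Dm_def]
  \<comment> \<open>Bordering \<open>W\<close> with a 1 extends the diagonalization of the block
    \<open>A3\<close> to all of \<open>B\<close>.\<close>
  define X where "X = four_block_mat (1\<^sub>m 1) (0\<^sub>m 1 m) (0\<^sub>m m 1) W"
  have X: "X \<in> carrier_mat n n" unfolding X_def nm using W by auto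
  have Xt: "transpose_mat X = four_block_mat (1\<^sub>m 1) (0\<^sub>m 1 m) (0\<^sub>m m 1) (transpose_mat W)"
    unfolding X_def using W by (subst transpose_four_block_mat[of _ 1 1 _ m _ m]) auto
  have D: "mat_diag n (\<lambda>i. (e # es) ! i) =
      four_block_mat E (0\<^sub>m 1 m) (0\<^sub>m m 1) Dm"
    unfolding nm by (rule eq_matI) (auto simp: Dm_def mat_diag_def E_def nth_Cons')
  have DX: "mat_diag n (\<lambda>i. (e # es) ! i) * X =
      four_block_mat E (0\<^sub>m 1 m) (0\<^sub>m m 1) (Dm * W)"
    unfolding D X_def using W E Dm
    by (subst mult_four_block_mat[of _ 1 1 _ m _ m _ _ 1 _ m]) auto
  have XDX: "transpose_mat X * (mat_diag n (\<lambda>i. (e # es) ! i) * X) = B"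
    unfolding DX Xt using W E Dm
    by (subst mult_four_block_mat[of _ 1 1 _ m _ m _ _ 1 _ m])
      (auto simp: B4 A1 A2 A0 A3W assoc_mult_mat[of _ m m _ m _ m])
  have XX: "transpose_mat X * X = 1\<^sub>m n"
    unfolding Xt unfolding X_def nm using W
    by (subst mult_four_block_mat[of _ 1 1 _ m _ m _ _ 1 _ m]) (auto simp: WW)
  define U where "U = X * transpose_mat V"
  have U: "U \<in> carrier_mat n n" using X V by (auto simp: U_def)
  have Ut: "transpose_mat U = V * transpose_mat X"
    unfolding U_def using X V by (simp add: transpose_mult[of _ n n _ n])
  have "transpose_mat U * U = V * (transpose_mat X * X) * transpose_mat V"
    unfolding Ut unfolding U_def using X V by (simp add: assoc_mult_mat[of _ n n _ n _ n])
  hence "transpose_mat U * U = 1\<^sub>m n" using V by (simp add: XX VtV)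
  moreover have "A = transpose_mat U * mat_diag n (\<lambda>i. (e # es) ! i) * U"
  proof -
    define F where "F = mat_diag n (\<lambda>i. (e # es) ! i)"
    have F: "F \<in> carrier_mat n n" by (simp add: F_def)
    show ?thesis unfolding Ut F_def[symmetric] unfolding U_def using X V F
      by (simp add: A_B XDX[symmetric] F_def[symmetric] assoc_mult_mat[of _ n n _ n _ n])
  qed
  ultimately show ?case using U by blast
qed

section \<open>Adjoints and forms of matrices congruent to diagonal ones\<close>

lemma mat_adjoint_eq: "mat_adjoint A = map_mat conjugate (transpose_mat A)"
  by (rule eq_matI) (auto simp: mat_adjoint_def mat_of_rows_def)

lemma mat_adjoint_dim [simp]:
  "dim_row (mat_adjoint A) = dim_col A" "dim_col (mat_adjoint A) = dim_row A"
  by (simp_all add: mat_adjoint_eq)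

lemma mat_adjoint_carrier: "A \<in> carrier_mat n m \<Longrightarrow> mat_adjoint A \<in> carrier_mat m n"
  by (simp add: mat_adjoint_eq)

lemma index_mat_adjoint [simp]:
  "i < dim_col A \<Longrightarrow> j < dim_row A \<Longrightarrow> mat_adjoint A $$ (i,j) = conjugate (A $$ (j,i))"
  by (simp add: mat_adjoint_eq)

lemma mat_adjoint_real [simp]: "mat_adjoint (A :: real mat) = transpose_mat A"
  by (rule eq_matI) (auto simp: mat_adjoint_eq)

lemma mat_adjoint_complex_mat [simp]: "mat_adjoint (complex_mat A) = complex_mat (transpose_mat A)"
  by (rule eq_matI) (auto simp: mat_adjoint_eq)

lemma index_mult_mat_diag:
  assumes "X \<in> carrier_mat m n" "Y \<in> carrier_mat n l" "i < m" "j < l"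
  shows "(X * mat_diag n f * Y) $$ (i,j) = (\<Sum>k<n. X $$ (i,k) * f k * Y $$ (k,j))"
  using assms
  by (subst mat_diag_mult_right[of _ m]) (auto simp: scalar_prod_def atLeast0LessThan intro!: sum.cong)

lemma scalar_prod_mat_adjoint:
  assumes "T \<in> carrier_mat n m" "x \<in> carrier_vec m" "y \<in> carrier_vec n"
  shows "(mat_adjoint T *\<^sub>v y) \<bullet>c x = y \<bullet>c (T *\<^sub>v x)"
proof -
  have "mat_adjoint T = transpose_mat (map_mat conjugate T)"
    using assms by (auto simp: mat_adjoint_eq)
  hence "(mat_adjoint T *\<^sub>v y) \<bullet>c x = y \<bullet> (map_mat conjugate T *\<^sub>v conjugate x)"
    using assms by (simp add: transpose_vec_mult_scalar[of _ n m])
  also have "map_mat conjugate T *\<^sub>v conjugate x = conjugate (T *\<^sub>v x)"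
    using assms
    by (intro eq_vecI) (auto simp: scalar_prod_def sum_conjugate conjugate_dist_mul intro!: sum.cong)
  finally show ?thesis .
qed

lemma mat_diag_mult_vec:
  "v \<in> carrier_vec n \<Longrightarrow> mat_diag n f *\<^sub>v v = vec n (\<lambda>i. f i * v $ i)"
  by (intro eq_vecI)
    (auto simp: mat_diag_def scalar_prod_def if_distrib [of "\<lambda>x. x * _"] sum.delta cong: if_cong)

text \<open>Moving the adjoint of \<open>T\<close> to the other factor leaves the diagonal matrix
  evaluated at \<open>T x\<close>. For phase factors \<open>f\<close> this exhibits the values of
  the form as nonnegative combinations of them.\<close>

lemma diagonal_form:
  assumes "T \<in> carrier_mat n n" "x \<in> carrier_vec n"
  shows "(mat_adjoint T * mat_diag n f * T *\<^sub>v x) \<bullet>c x =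
    (\<Sum>k<n. f k * ((T *\<^sub>v x) $ k * conjugate ((T *\<^sub>v x) $ k)))"
proof -
  have T: "T *\<^sub>v x \<in> carrier_vec n" using assms by auto
  have "(mat_adjoint T * mat_diag n f * T *\<^sub>v x) = mat_adjoint T *\<^sub>v (mat_diag n f *\<^sub>v (T *\<^sub>v x))"
    using assms mat_diag_dim[of n f] mat_adjoint_carrier[OF assms(1)]
    by (simp add: assoc_mult_mat_vec[of _ n n _ n] del: mat_diag_dim)
  also have "\<dots> \<bullet>c x = (mat_diag n f *\<^sub>v (T *\<^sub>v x)) \<bullet>c (T *\<^sub>v x)"
    using assms T by (intro scalar_prod_mat_adjoint) (auto simp: mat_diag_mult_vec)
  also have "\<dots> = (\<Sum>k<n. f k * ((T *\<^sub>v x) $ k * conjugate ((T *\<^sub>v x) $ k)))"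
    using T assms(1) unfolding mat_diag_mult_vec[OF T]
    by (auto simp del: index_mult_mat_vec simp: scalar_prod_def[of _ "conjugate _"] atLeast0LessThan mult.assoc intro!: sum.cong)
  finally show ?thesis .
qed


lemma complex_mat_mult:
  "A \<in> carrier_mat n m \<Longrightarrow> B \<in> carrier_mat m l \<Longrightarrow> complex_mat (A * B) = complex_mat A * complex_mat B"
  by (rule of_real_hom.mat_hom_mult)

lemma hermitian_eigenvalue_real:
  fixes A :: "complex mat"
  assumes A: "A \<in> carrier_mat n n" and h: "mat_adjoint A = A" and ev: "eigenvalue A e"
  shows "e \<in> \<real>"
proof -
  from ev obtain v where v: "v \<in> carrier_vec n" "v \<noteq> 0\<^sub>v n" "A *\<^sub>v v = e \<cdot>\<^sub>v v"
    unfolding eigenvalue_def eigenvector_def using A by auto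
  have "e * (v \<bullet>c v) = (A *\<^sub>v v) \<bullet>c v" using v by simp
  also have "\<dots> = v \<bullet>c (A *\<^sub>v v)" using scalar_prod_mat_adjoint[OF A v(1) v(1)] h by simp
  also have "\<dots> = cnj e * (v \<bullet>c v)" using v by (simp add: conjugate_smult_vec)
  finally show ?thesis using v by (auto simp: Reals_cnj_iff)
qed

text \<open>The complex roots are eigenvalues of a Hermitian matrix, hence real; as the embedding of
  real into complex polynomials is injective, the complex factorization descends to the
  reals.\<close>

lemma char_poly_real_symmetric_splits:
  fixes A :: "real mat"
  assumes A: "A \<in> carrier_mat n n" and t: "transpose_mat A = A"
  shows "\<exists>es. char_poly A = (\<Prod>e\<leftarrow>es. [:- e, 1:])"
proof -
  interpret p: map_poly_inj_comm_ring_hom complex_of_real ..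
  have cA: "complex_mat A \<in> carrier_mat n n" using A by auto
  from char_poly_factorized[OF cA] obtain as where
    as: "char_poly (complex_mat A) = (\<Prod>a\<leftarrow>as. [:- a, 1:])" by auto
  have "a \<in> \<real>" if "a \<in> set as" for a
  proof (rule hermitian_eigenvalue_real[OF cA])
    show "eigenvalue (complex_mat A) a"
      unfolding eigenvalue_root_char_poly[OF cA] as using that by (simp add: poly_prod_list_zero_iff)
  qed (simp add: t)
  hence "map (complex_of_real \<circ> Re) as = as" by (intro map_idI) auto
  hence as': "as = map complex_of_real (map Re as)" unfolding map_map by (rule sym)
  have "map_poly complex_of_real (char_poly A) = (\<Prod>a\<leftarrow>map complex_of_real (map Re as). [:- a, 1:])"
    unfolding of_real_hom.char_poly_hom[OF A, symmetric] as as'[symmetric] ..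
  also have "\<dots> = map_poly complex_of_real (\<Prod>a\<leftarrow>map Re as. [:- a, 1:])"
    by (induction ("map Re as")) (simp_all add: p.hom_mult del: mult_pCons_left)
  finally have "char_poly A = (\<Prod>a\<leftarrow>map Re as. [:- a, 1:])" by (rule p.injectivity)
  thus ?thesis by blast
qed


lemma invertible_mat_mult_vec_nonzero:
  fixes T :: "'a :: field mat"
  assumes "T \<in> carrier_mat n n" "invertible_mat T" "x \<in> carrier_vec n" "x \<noteq> 0\<^sub>v n"
  shows "T *\<^sub>v x \<noteq> 0\<^sub>v n"
proof
  assume 0: "T *\<^sub>v x = 0\<^sub>v n"
  obtain T' where T': "T' * T = 1\<^sub>m (dim_row T')" "T * T' = 1\<^sub>m n"
    using assms unfolding invertible_mat_def inverts_mat_def by auto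
  from arg_cong[OF T'(1), of dim_col] arg_cong[OF T'(2), of dim_col] assms(1)
  have c: "T' \<in> carrier_mat n n" by auto
  have "x = T' *\<^sub>v (T *\<^sub>v x)"
    using c assms T'(1) by (subst assoc_mult_mat_vec[symmetric, of _ n n _ n]) auto
  also have "\<dots> = 0\<^sub>v n" unfolding 0 using c by auto
  finally show False using assms by simp
qed

lemma diagonal_form_Re_pos:
  fixes T :: "complex mat"
  assumes "T \<in> carrier_mat n n" "invertible_mat T" "x \<in> carrier_vec n" "x \<noteq> 0\<^sub>v n"
    and f: "\<And>k. k < n \<Longrightarrow> 0 < Re (f k)"
  shows "0 < Re ((mat_adjoint T * mat_diag n f * T *\<^sub>v x) \<bullet>c x)"
proof -
  define y where "y = T *\<^sub>v x"
  have y: "y \<in> carrier_vec n" "y \<noteq> 0\<^sub>v n"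
    using assms invertible_mat_mult_vec_nonzero[OF assms(1-4)] by (auto simp: y_def)
  obtain i where i: "i < n" "y $ i \<noteq> 0"
    using y by (metis carrier_vecD eq_vecI index_zero_vec)
  have "Re ((mat_adjoint T * mat_diag n f * T *\<^sub>v x) \<bullet>c x) = (\<Sum>k<n. Re (f k) * (cmod (y $ k))\<^sup>2)"
    unfolding diagonal_form[OF assms(1,3)] Re_sum
    by (intro sum.cong) (auto simp: y_def[symmetric] complex_mult_cnj cmod_power2)
  also have "\<dots> > 0"
    using i f by (intro sum_pos2[of _ i]) (auto simp: less_imp_le)
  finally show ?thesis .
qed

lemma complex_mat_form:
  assumes "A \<in> carrier_mat n n" "x \<in> carrier_vec n"
  shows "(complex_mat A *\<^sub>v map_vec of_real x) \<bullet>c map_vec of_real x = of_real ((A *\<^sub>v x) \<bullet> x)"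
proof -
  have "complex_mat A *\<^sub>v map_vec of_real x = map_vec complex_of_real (A *\<^sub>v x)"
    by (rule of_real_hom.mult_mat_vec_hom[OF assms, symmetric])
  moreover have "conjugate (map_vec complex_of_real x) = map_vec of_real x" by (intro eq_vecI) auto
  ultimately show ?thesis using assms by (simp add: scalar_prod_def)
qed

lemma index_mult_mat_diag_complex_mat:
  assumes "R \<in> carrier_mat n n" "i < n" "j < n"
  shows "(transpose_mat (complex_mat R) * mat_diag n f * complex_mat R) $$ (i,j) =
    (\<Sum>k<n. of_real (R $$ (k,i)) * f k * of_real (R $$ (k,j)))"
  using assms by (subst index_mult_mat_diag[of _ n n]) auto

section \<open>Positive definite factorization and simultaneous diagonalization\<close>

text \<open>Positivity makes the diagonal in an orthogonal diagonalization positive, so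
  \<open>L\<close> can be taken as its square root times \<open>U\<close>.\<close>

lemma real_positive_definite_factorization:
  fixes P :: "real mat"
  assumes P: "P \<in> carrier_mat n n" and t: "transpose_mat P = P"
    and pos: "\<And>x. x \<in> carrier_vec n \<Longrightarrow> x \<noteq> 0\<^sub>v n \<Longrightarrow> 0 < (P *\<^sub>v x) \<bullet> x"
  obtains L L' where "L \<in> carrier_mat n n" "L' \<in> carrier_mat n n"
    "L * L' = 1\<^sub>m n" "L' * L = 1\<^sub>m n" "P = transpose_mat L * L"
proof -
  from char_poly_real_symmetric_splits[OF P t] real_symmetric_diagonalization[OF P t]
  obtain es U where U: "U \<in> carrier_mat n n" and UU: "transpose_mat U * U = 1\<^sub>m n"
    and PU: "P = transpose_mat U * mat_diag n (\<lambda>i. es ! i) * U" by blast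
  have Ut: "transpose_mat U \<in> carrier_mat n n" using U by auto
  have UUt: "U * transpose_mat U = 1\<^sub>m n"
    by (rule mat_mult_left_right_inverse[OF Ut U UU])
  have es: "0 < es ! i" if i: "i < n" for i
  proof -
    \<comment> \<open>This is the eigenvector of \<open>P\<close> for \<open>es ! i\<close>, at
      which the form takes the value \<open>es ! i\<close>.\<close>
    define x where "x = transpose_mat U *\<^sub>v unit_vec n i"
    have x: "x \<in> carrier_vec n" using Ut by (auto simp: x_def)
    have Ux: "U *\<^sub>v x = unit_vec n i"
      unfolding x_def using U Ut UUt
      by (subst assoc_mult_mat_vec[symmetric, of _ n n _ n]) auto
    have "x \<noteq> 0\<^sub>v n"
    proof
      assume "x = 0\<^sub>v n"
      hence "U *\<^sub>v x = 0\<^sub>v n" using U by auto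
      hence "unit_vec n i $ i = (0\<^sub>v n :: real vec) $ i" using Ux by simp
      thus False using i by simp
    qed
    hence "0 < (P *\<^sub>v x) \<bullet> x" using pos x by blast
    also have "\<dots> = (\<Sum>k<n. es ! k * (unit_vec n i $ k * unit_vec n i $ k))"
      using diagonal_form[OF U x, of "\<lambda>i. es ! i"] by (simp add: PU Ux)
    also have "\<dots> = (\<Sum>k<n. if k = i then es ! i else 0)"
      using i by (intro sum.cong) auto
    also have "\<dots> = es ! i" using i by simp
    finally show ?thesis .
  qed
  define s where "s i = sqrt (es ! i)" for i
  define Ds where "Ds = mat_diag n s"
  define Di where "Di = mat_diag n (\<lambda>i. 1 / s i)"
  have D: "Ds \<in> carrier_mat n n" "Di \<in> carrier_mat n n" by (auto simp: Ds_def Di_def)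
  have DD: "Ds * Di = 1\<^sub>m n" "Ds * Ds = mat_diag n (\<lambda>i. es ! i)" "transpose_mat Ds = Ds"
  proof -
    have "s i * (1 / s i) = 1" "s i * s i = es ! i" if "i < n" for i
      using es[OF that] by (auto simp: s_def)
    thus "Ds * Di = 1\<^sub>m n" "Ds * Ds = mat_diag n (\<lambda>i. es ! i)"
      unfolding Ds_def Di_def mat_diag_diag by (auto simp: mat_diag_def)
  qed (auto simp: Ds_def mat_diag_def)
  define L where "L = Ds * U"
  define L' where "L' = transpose_mat U * Di"
  have L: "L \<in> carrier_mat n n" and L': "L' \<in> carrier_mat n n" using U D by (auto simp: L_def L'_def)
  have "L * L' = Ds * (U * transpose_mat U) * Di"
    unfolding L_def L'_def using U D Ut by (simp add: assoc_mult_mat[of _ n n _ n _ n])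
  hence LL': "L * L' = 1\<^sub>m n" using D DD UUt by simp
  have "transpose_mat L * L = transpose_mat U * (Ds * Ds) * U"
    unfolding L_def using U D Ut
    by (simp add: assoc_mult_mat[of _ n n _ n _ n] transpose_mult[of _ n n _ n] DD(3))
  hence "P = transpose_mat L * L" using PU DD(2) by simp
  with that L L' LL' mat_mult_left_right_inverse[OF L L' LL'] show thesis by blast
qed

text \<open>A complex simultaneous diagonalization of two real symmetric matrices is traded for a
  real one with the same diagonal. Once \<open>L\<close> has normalized \<open>P\<close> to the
  identity, the transform \<open>B\<close> of \<open>Q\<close> is unitarily similar to the diagonal
  matrix of \<open>t\<close>, so its characteristic polynomial splits over the reals and an
  orthogonal \<open>W\<close> diagonalizes it.\<close>

lemma simultaneous_real_diagonalization:
  fixes P Q :: "real mat" and S :: "complex mat" and t :: "nat \<Rightarrow> real"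
  assumes P: "P \<in> carrier_mat n n" "transpose_mat P = P"
    and Q: "Q \<in> carrier_mat n n" "transpose_mat Q = Q"
    and pos: "\<And>x. x \<in> carrier_vec n \<Longrightarrow> x \<noteq> 0\<^sub>v n \<Longrightarrow> 0 < (P *\<^sub>v x) \<bullet> x"
    and S: "S \<in> carrier_mat n n"
    and PS: "complex_mat P = mat_adjoint S * S"
    and QS: "complex_mat Q = mat_adjoint S * mat_diag n (\<lambda>i. of_real (t i)) * S"
  obtains R R' where "R \<in> carrier_mat n n" "R' \<in> carrier_mat n n"
    "R * R' = 1\<^sub>m n" "R' * R = 1\<^sub>m n"
    "P = transpose_mat R * R" "Q = transpose_mat R * mat_diag n t * R"
proof -
  obtain L L' where L: "L \<in> carrier_mat n n" and L': "L' \<in> carrier_mat n n"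
    and LL': "L * L' = 1\<^sub>m n" and L'L: "L' * L = 1\<^sub>m n" and PL: "P = transpose_mat L * L"
    using real_positive_definite_factorization[OF P pos] by blast
  have Lt: "transpose_mat L \<in> carrier_mat n n" "transpose_mat L' \<in> carrier_mat n n" using L L' by auto
  have LtL: "transpose_mat L' * transpose_mat L = 1\<^sub>m n" "transpose_mat L * transpose_mat L' = 1\<^sub>m n"
    unfolding transpose_mult[OF L L', symmetric] transpose_mult[OF L' L, symmetric] LL' L'L by auto
  define B where "B = transpose_mat L' * Q * L'"
  have B: "B \<in> carrier_mat n n" using Q Lt L' by (auto simp: B_def)
  have Bt: "transpose_mat B = B"
    unfolding B_def using L' Q
    by (simp add: transpose_mult[of _ n n _ n] assoc_mult_mat[of _ n n _ n _ n])
  define D where "D = mat_diag n (\<lambda>i. complex_of_real (t i))"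
  have D: "D \<in> carrier_mat n n" by (simp add: D_def)
  have S': "mat_adjoint S \<in> carrier_mat n n" using S by (rule mat_adjoint_carrier)
  \<comment> \<open>\<open>Z'\<close> is the adjoint of \<open>Z\<close>, and \<open>Z' * Z\<close>
    is the transform of \<open>P\<close>, which is the identity; thus \<open>Z\<close> is
    unitary.\<close>
  define Z where "Z = S * complex_mat L'"
  define Z' where "Z' = transpose_mat (complex_mat L') * mat_adjoint S"
  have cL: "complex_mat L' \<in> carrier_mat n n" "transpose_mat (complex_mat L') \<in> carrier_mat n n"
    using L' by auto
  have cLt: "transpose_mat (complex_mat L') = complex_mat (transpose_mat L')" by auto
  have Z: "Z \<in> carrier_mat n n" "Z' \<in> carrier_mat n n" using S S' cL by (auto simp: Z_def Z'_def)
  have BZ: "complex_mat B = Z' * D * Z"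
  proof -
    have "complex_mat B = transpose_mat (complex_mat L') * complex_mat Q * complex_mat L'"
      unfolding B_def cLt using Lt L' Q by (simp add: complex_mat_mult[of _ n n _ n])
    thus ?thesis unfolding QS D_def[symmetric] Z_def Z'_def using S S' cL D
      by (simp add: assoc_mult_mat[of _ n n _ n _ n])
  qed
  have Z'Z: "Z' * Z = 1\<^sub>m n"
  proof -
    have "Z' * Z = transpose_mat (complex_mat L') * complex_mat P * complex_mat L'"
      unfolding PS Z_def Z'_def using S S' cL by (simp add: assoc_mult_mat[of _ n n _ n _ n])
    also have "\<dots> = complex_mat (transpose_mat L' * P * L')"
      unfolding cLt using Lt L' P by (simp add: complex_mat_mult[of _ n n _ n])
    also have "transpose_mat L' * P * L' = (transpose_mat L' * transpose_mat L) * (L * L')"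
      unfolding PL using Lt L L' by (simp add: assoc_mult_mat[of _ n n _ n _ n])
    finally show ?thesis by (simp add: LtL LL' of_real_hom.mat_hom_one)
  qed
  have sim: "similar_mat (complex_mat B) D"
    unfolding similar_mat_def
    by (intro exI, rule similar_mat_witI[of Z' Z n "complex_mat B" D])
      (use Z'Z mat_mult_left_right_inverse[OF Z(2,1) Z'Z] BZ D B Z in auto)
  interpret p: map_poly_inj_comm_ring_hom complex_of_real ..
  have "map_poly complex_of_real (char_poly B) = char_poly D"
    unfolding of_real_hom.char_poly_hom[OF B, symmetric] by (rule char_poly_similar[OF sim])
  also have "\<dots> = (\<Prod>a\<leftarrow>map (\<lambda>i. complex_of_real (t i)) [0..<n]. [:- a, 1:])"
    by (subst char_poly_upper_triangular[OF D])
      (auto simp: D_def mat_diag_def diag_mat_def upper_triangular_def intro!: arg_cong[of _ _ prod_list])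
  also have "\<dots> = map_poly complex_of_real (\<Prod>a\<leftarrow>map t [0..<n]. [:- a, 1:])"
    by (induction n) (simp_all add: p.hom_mult del: mult_pCons_left mult_pCons_right)
  finally have "char_poly B = (\<Prod>a\<leftarrow>map t [0..<n]. [:- a, 1:])" by (rule p.injectivity)
  \<comment> \<open>The roots are listed in the order of \<open>t\<close>, so the diagonal agrees
    with \<open>t\<close> index by index without a permutation.\<close>
  from real_symmetric_diagonalization[OF B Bt this] obtain W where W: "W \<in> carrier_mat n n"
    and WW: "transpose_mat W * W = 1\<^sub>m n"
    and BW: "B = transpose_mat W * mat_diag n (\<lambda>i. map t [0..<n] ! i) * W" by blast
  define E where "E = mat_diag n t"
  have E: "E \<in> carrier_mat n n" by (simp add: E_def)
  have "mat_diag n (\<lambda>i. map t [0..<n] ! i) = E"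
    by (rule eq_matI) (auto simp: mat_diag_def E_def)
  note BW = BW[unfolded this]
  have Wt: "transpose_mat W \<in> carrier_mat n n" using W by auto
  have WWt: "W * transpose_mat W = 1\<^sub>m n" by (rule mat_mult_left_right_inverse[OF Wt W WW])
  define R where "R = W * L"
  define R' where "R' = L' * transpose_mat W"
  have R: "R \<in> carrier_mat n n" "R' \<in> carrier_mat n n" using W Wt L L' by (auto simp: R_def R'_def)
  have Rt: "transpose_mat R = transpose_mat L * transpose_mat W"
    unfolding R_def using W L by (simp add: transpose_mult[of _ n n _ n])
  have "R * R' = W * (L * L') * transpose_mat W"
    unfolding R_def R'_def using W Wt L L' by (simp add: assoc_mult_mat[of _ n n _ n _ n])
  hence RR': "R * R' = 1\<^sub>m n" using W LL' WWt by simp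
  have "transpose_mat R * R = transpose_mat L * (transpose_mat W * W) * L"
    unfolding Rt unfolding R_def using W Wt L Lt by (simp add: assoc_mult_mat[of _ n n _ n _ n])
  hence PR: "P = transpose_mat R * R" using WW L Lt PL by simp
  have "transpose_mat R * E * R = transpose_mat L * B * L"
    unfolding Rt BW unfolding R_def using W Wt L Lt E by (simp add: assoc_mult_mat[of _ n n _ n _ n])
  also have "\<dots> = (transpose_mat L * transpose_mat L') * Q * (L' * L)"
    unfolding B_def using L Lt L' Q by (simp add: assoc_mult_mat[of _ n n _ n _ n])
  finally have "Q = transpose_mat R * E * R" using LtL L'L Q by simp
  with that R RR' mat_mult_left_right_inverse[OF R RR'] PR show thesis unfolding E_def by blast
qed


text \<open>For a symmetric matrix the entrywise conjugate is the adjoint. Hence the entrywise real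
  part of the rotated \<open>M\<close> is its Hermitian part, and \<open>\<i>\<close> times the
  imaginary part is its skew-Hermitian part. \<open>T\<close> diagonalizes both, with the cosines
  and sines of the rotated phases, and since both are real, \<open>T\<close> can be replaced by a
  real matrix.\<close>

lemma sectorial_symmetric_real_congruence:
  assumes M: "M \<in> carrier_mat n n" and t: "transpose_mat M = M"
    and sec: "sectorial_with_phases n M \<mu>" and n: "n \<noteq> 0"
  obtains R R' :: "real mat" where "R \<in> carrier_mat n n" "R' \<in> carrier_mat n n"
    "R * R' = 1\<^sub>m n" "R' * R = 1\<^sub>m n"
    "M = transpose_mat (complex_mat R) * mat_diag n (\<lambda>i. cis (\<mu> (Suc i))) * complex_mat R"
proof -
  from sec obtain T where T: "T \<in> carrier_mat n n" and inv: "invertible_mat T"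
    and MT: "M = mat_adjoint T * mat_diag n (\<lambda>i. cis (\<mu> (Suc i))) * T"
    and mono: "antimono_on {1..n} \<mu>" and gap: "\<mu> 1 - \<mu> n < pi"
    unfolding sectorial_with_phases_def by blast
  have T': "mat_adjoint T \<in> carrier_mat n n" using T by (rule mat_adjoint_carrier)
  \<comment> \<open>Rotation by the midpoint of the extreme phases brings all of them strictly
    within \<open>pi / 2\<close> of zero, so the cosines \<open>c\<close> are positive.\<close>
  define \<alpha> where "\<alpha> = (\<mu> 1 + \<mu> n) / 2"
  define c where "c i = cos (\<mu> (Suc i) - \<alpha>)" for i
  define s where "s i = sin (\<mu> (Suc i) - \<alpha>)" for i
  define \<tau> where "\<tau> i = s i / c i" for i
  have c: "0 < c i" if "i < n" for i
  proof -
    have "\<mu> n \<le> \<mu> (Suc i)" "\<mu> (Suc i) \<le> \<mu> 1"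
      using mono that n by (auto intro!: monotone_onD[OF mono])
    hence "\<bar>\<mu> (Suc i) - \<alpha>\<bar> < pi / 2" using gap unfolding \<alpha>_def by (auto simp: abs_if field_simps)
    thus ?thesis unfolding c_def by (intro cos_gt_zero_pi; linarith)
  qed
  define P where "P = mat n n (\<lambda>ij. Re (cis (- \<alpha>) * M $$ ij))"
  define Q where "Q = mat n n (\<lambda>ij. Im (cis (- \<alpha>) * M $$ ij))"
  have P: "P \<in> carrier_mat n n" and Q: "Q \<in> carrier_mat n n" by (auto simp: P_def Q_def)
  have Msym: "M $$ (i,j) = M $$ (j,i)" if "i < n" "j < n" for i j
    using arg_cong[OF t, of "\<lambda>X. X $$ (j,i)"] M that by auto
  have Pt: "transpose_mat P = P" and Qt: "transpose_mat Q = Q"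
    using Msym by (auto simp: P_def Q_def intro!: eq_matI)
  have N: "cis (- \<alpha>) * M $$ (i,j) = (\<Sum>k<n. cnj (T $$ (k,i)) * (c k + \<i> * s k) * T $$ (k,j))"
    if "i < n" "j < n" for i j
  proof -
    have "cis (- \<alpha>) * cis (\<mu> (Suc k)) = c k + \<i> * s k" for k
      by (simp add: cis_mult c_def s_def complex_eq_iff)
    note this[symmetric]
    thus ?thesis unfolding MT using T T' that
      by (subst index_mult_mat_diag[of _ n n]) (auto simp: sum_distrib_left intro!: sum.cong)
  qed
  \<comment> \<open>Symmetry of \<open>M\<close> enters here: conjugation amounts to flipping the
    sign of the sines, so the sum and the difference with the previous formula isolate
    \<open>c\<close> and \<open>s\<close>.\<close>
  have N': "cnj (cis (- \<alpha>) * M $$ (i,j)) = (\<Sum>k<n. cnj (T $$ (k,i)) * (c k - \<i> * s k) * T $$ (k,j))"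
    if "i < n" "j < n" for i j
    unfolding Msym[OF that] N[OF that(2,1)] cnj_sum by (intro sum.cong) (auto simp: mult_ac)
  have cP: "complex_mat P = mat_adjoint T * mat_diag n (\<lambda>i. of_real (c i)) * T"
  proof (rule eq_matI)
    fix i j assume "i < dim_row (mat_adjoint T * mat_diag n (\<lambda>i. of_real (c i)) * T)"
      "j < dim_col (mat_adjoint T * mat_diag n (\<lambda>i. of_real (c i)) * T)"
    hence ij: "i < n" "j < n" using T by auto
    have "2 * of_real (P $$ (i,j)) = cis (- \<alpha>) * M $$ (i,j) + cnj (cis (- \<alpha>) * M $$ (i,j))"
      unfolding complex_add_cnj using ij by (simp add: P_def)
    also have "\<dots> = 2 * (\<Sum>k<n. cnj (T $$ (k,i)) * c k * T $$ (k,j))"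
      unfolding N'[OF ij] unfolding N[OF ij] sum.distrib[symmetric] sum_distrib_left
      by (intro sum.cong) (auto simp: algebra_simps)
    finally show "complex_mat P $$ (i,j) = (mat_adjoint T * mat_diag n (\<lambda>i. of_real (c i)) * T) $$ (i,j)"
      using ij P T T' by (subst index_mult_mat_diag[of _ n n]) auto
  qed (use T P in auto)
  have cQ: "complex_mat Q = mat_adjoint T * mat_diag n (\<lambda>i. of_real (s i)) * T"
  proof (rule eq_matI)
    fix i j assume "i < dim_row (mat_adjoint T * mat_diag n (\<lambda>i. of_real (s i)) * T)"
      "j < dim_col (mat_adjoint T * mat_diag n (\<lambda>i. of_real (s i)) * T)"
    hence ij: "i < n" "j < n" using T by auto
    have "2 * \<i> * of_real (Q $$ (i,j)) = cis (- \<alpha>) * M $$ (i,j) - cnj (cis (- \<alpha>) * M $$ (i,j))"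
      unfolding complex_diff_cnj using ij by (simp add: Q_def)
    also have "\<dots> = 2 * \<i> * (\<Sum>k<n. cnj (T $$ (k,i)) * s k * T $$ (k,j))"
      unfolding N'[OF ij] unfolding N[OF ij] sum_subtractf[symmetric] sum_distrib_left
      by (intro sum.cong) (auto simp: algebra_simps)
    finally show "complex_mat Q $$ (i,j) = (mat_adjoint T * mat_diag n (\<lambda>i. of_real (s i)) * T) $$ (i,j)"
      using ij Q T T' by (subst index_mult_mat_diag[of _ n n]) auto
  qed (use T Q in auto)
  \<comment> \<open>Scaling row \<open>k\<close> of \<open>T\<close> by the square root of
    \<open>c k\<close> turns \<open>P\<close> into the adjoint of \<open>S\<close> times
    \<open>S\<close>; the diagonal left for \<open>Q\<close> consists of the tangents
    \<open>\<tau>\<close>.\<close>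
  define S where "S = mat n n (\<lambda>(i,j). of_real (sqrt (c i)) * T $$ (i,j))"
  have S: "S \<in> carrier_mat n n" by (simp add: S_def)
  have SS: "mat_adjoint S * mat_diag n (\<lambda>i. of_real (f i)) * S =
      mat_adjoint T * mat_diag n (\<lambda>i. of_real (c i * f i)) * T" for f
  proof (rule eq_matI)
    fix i j assume "i < dim_row (mat_adjoint T * mat_diag n (\<lambda>i. of_real (c i * f i)) * T)"
      "j < dim_col (mat_adjoint T * mat_diag n (\<lambda>i. of_real (c i * f i)) * T)"
    hence ij: "i < n" "j < n" using T by auto
    have "(mat_adjoint S * mat_diag n (\<lambda>i. of_real (f i)) * S) $$ (i,j) =
        (\<Sum>k<n. cnj (S $$ (k,i)) * f k * S $$ (k,j))"
      using ij S mat_adjoint_carrier[OF S] by (subst index_mult_mat_diag[of _ n n]) auto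
    also have "\<dots> = (\<Sum>k<n. cnj (T $$ (k,i)) * of_real (c k * f k) * T $$ (k,j))"
    proof (intro sum.cong refl)
      fix k assume "k \<in> {..<n}"
      hence k: "k < n" by simp
      hence "complex_of_real (c k) = of_real (sqrt (c k)) * of_real (sqrt (c k))"
        using c[OF k] by (simp flip: of_real_mult)
      thus "cnj (S $$ (k,i)) * f k * S $$ (k,j) = cnj (T $$ (k,i)) * of_real (c k * f k) * T $$ (k,j)"
        using ij k by (simp add: S_def)
    qed
    also have "\<dots> = (mat_adjoint T * mat_diag n (\<lambda>i. of_real (c i * f i)) * T) $$ (i,j)"
      using ij T T' by (subst index_mult_mat_diag[of _ n n]) auto
    finally show "(mat_adjoint S * mat_diag n (\<lambda>i. of_real (f i)) * S) $$ (i,j) = \<dots>" .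
  qed (use S T in auto)
  have PS: "complex_mat P = mat_adjoint S * S"
    using SS[of "\<lambda>_. 1"] cP S mat_adjoint_carrier[OF S] by simp
  have QS: "complex_mat Q = mat_adjoint S * mat_diag n (\<lambda>i. of_real (\<tau> i)) * S"
  proof -
    have "mat_diag n (\<lambda>i. complex_of_real (c i * \<tau> i)) = mat_diag n (\<lambda>i. of_real (s i))"
      using c by (intro eq_matI) (auto simp: mat_diag_def \<tau>_def less_imp_neq[symmetric])
    thus ?thesis unfolding SS cQ by simp
  qed
  have pos: "0 < (P *\<^sub>v x) \<bullet> x" if x: "x \<in> carrier_vec n" and x0: "x \<noteq> 0\<^sub>v n" for x
  proof -
    have cx: "map_vec complex_of_real x \<in> carrier_vec n" "map_vec complex_of_real x \<noteq> 0\<^sub>v n"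
      using x x0 by (auto simp: vec_eq_iff)
    have "0 < Re ((complex_mat P *\<^sub>v map_vec of_real x) \<bullet>c map_vec of_real x)"
      unfolding cP using c by (intro diagonal_form_Re_pos[OF T inv cx]) auto
    thus ?thesis unfolding complex_mat_form[OF P x] by simp
  qed
  obtain R0 R0' where R0: "R0 \<in> carrier_mat n n" "R0' \<in> carrier_mat n n"
    and R0R0': "R0 * R0' = 1\<^sub>m n" "R0' * R0 = 1\<^sub>m n"
    and PR: "P = transpose_mat R0 * R0" and QR: "Q = transpose_mat R0 * mat_diag n \<tau> * R0"
    using simultaneous_real_diagonalization[OF P Pt Q Qt pos S PS QS] by blast
  \<comment> \<open>The rows of \<open>R0\<close> still carry the square roots of the cosines.
    Dividing them out leaves
    \<open>c k * (1 + \<i> * \<tau> k) = cis (\<mu> (Suc k) - \<alpha>)\<close> on the diagonal, of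
    modulus one.\<close>
  define E where "E = mat_diag n (\<lambda>i. 1 / sqrt (c i))"
  define E' where "E' = mat_diag n (\<lambda>i. sqrt (c i))"
  have E: "E \<in> carrier_mat n n" "E' \<in> carrier_mat n n" by (auto simp: E_def E'_def)
  have EE: "E * E' = 1\<^sub>m n"
    unfolding E_def E'_def mat_diag_diag using c
    by (auto simp: mat_diag_def less_imp_neq[symmetric] intro!: eq_matI)
  define R where "R = E * R0"
  define R' where "R' = R0' * E'"
  have R: "R \<in> carrier_mat n n" "R' \<in> carrier_mat n n" using R0 E by (auto simp: R_def R'_def)
  have "R * R' = E * (R0 * R0') * E'"
    unfolding R_def R'_def using R0 E by (simp add: assoc_mult_mat[of _ n n _ n _ n])
  hence RR': "R * R' = 1\<^sub>m n" using E EE R0R0' by simp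
  have Rij: "R $$ (i,j) = R0 $$ (i,j) / sqrt (c i)" if "i < n" "j < n" for i j
    unfolding R_def E_def using R0(1) that by (subst mat_diag_mult_left[of _ n n]) auto
  have "M = transpose_mat (complex_mat R) * mat_diag n (\<lambda>i. cis (\<mu> (Suc i))) * complex_mat R" (is "_ = ?A")
  proof (rule eq_matI)
    fix i j assume "i < dim_row ?A" "j < dim_col ?A"
    hence ij: "i < n" "j < n" using R by auto
    have P': "P $$ (i,j) = (\<Sum>k<n. R0 $$ (k,i) * R0 $$ (k,j))"
      unfolding PR using R0 ij by (auto simp: scalar_prod_def atLeast0LessThan)
    have Q': "Q $$ (i,j) = (\<Sum>k<n. R0 $$ (k,i) * \<tau> k * R0 $$ (k,j))"
      unfolding QR using R0 ij by (subst index_mult_mat_diag[of _ n n]) auto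
    have "M $$ (i,j) = cis \<alpha> * (cis (- \<alpha>) * M $$ (i,j))"
      unfolding mult.assoc[symmetric] cis_mult by simp
    also have "cis (- \<alpha>) * M $$ (i,j) = of_real (P $$ (i,j)) + \<i> * of_real (Q $$ (i,j))"
      using ij by (simp add: P_def Q_def complex_eq_iff)
    also have "\<dots> = (\<Sum>k<n. of_real (R0 $$ (k,i) * R0 $$ (k,j)) * (1 + \<i> * \<tau> k))"
      unfolding P' Q' of_real_sum sum_distrib_left sum.distrib[symmetric]
      by (intro sum.cong) (auto simp: algebra_simps)
    also have "cis \<alpha> * \<dots> = (\<Sum>k<n. of_real (R $$ (k,i)) * cis (\<mu> (Suc k)) * of_real (R $$ (k,j)))"
      unfolding sum_distrib_left
    proof (intro sum.cong refl)
      fix k assume "k \<in> {..<n}"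
      hence k: "k < n" by simp
      have "c k \<noteq> 0" using c[OF k] by simp
      hence "c k * (1 + \<i> * \<tau> k) = cis (\<mu> (Suc k) - \<alpha>)"
        by (simp add: \<tau>_def c_def s_def complex_eq_iff)
      hence 1: "cis \<alpha> * (c k * (1 + \<i> * \<tau> k)) = cis (\<mu> (Suc k))" by (simp add: cis_mult)
      have 2: "complex_of_real (R $$ (k,i)) * of_real (R $$ (k,j)) * c k =
          of_real (R0 $$ (k,i) * R0 $$ (k,j))"
        using c[OF k] k ij by (simp add: Rij flip: of_real_mult of_real_divide)
      show "cis \<alpha> * (of_real (R0 $$ (k,i) * R0 $$ (k,j)) * (1 + \<i> * \<tau> k)) =
          of_real (R $$ (k,i)) * cis (\<mu> (Suc k)) * of_real (R $$ (k,j))"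
        unfolding 2[symmetric] 1[symmetric] by (simp only: mult_ac)
    qed
    also have "\<dots> = ?A $$ (i,j)" using index_mult_mat_diag_complex_mat[OF R(1) ij] by simp
    finally show "M $$ (i,j) = ?A $$ (i,j)" .
  qed (use M R in auto)
  with that R RR' mat_mult_left_right_inverse[OF R RR'] show thesis by blast
qed

section \<open>Quadratic forms at a singular perturbation\<close>

lemma complex_mat_mult_conjugate_vec:
  assumes "A \<in> carrier_mat n m" "z \<in> carrier_vec m"
  shows "complex_mat A *\<^sub>v conjugate z = conjugate (complex_mat A *\<^sub>v z)"
  using assms by (intro eq_vecI) (auto simp: scalar_prod_def sum_conjugate intro!: sum.cong)

text \<open>A real matrix commutes with conjugation of vectors, so the products that involve the
  conjugate of \<open>z\<close> are conjugates of \<open>p\<close> and \<open>q\<close>, and no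
  further quantities enter.\<close>

lemma complex_mat_form_conjugate_pair:
  fixes A :: "real mat" and z :: "complex vec" and a b :: complex
  assumes A: "A \<in> carrier_mat n n" and z: "z \<in> carrier_vec n"
  defines "x \<equiv> a \<cdot>\<^sub>v z + b \<cdot>\<^sub>v conjugate z"
    and "p \<equiv> (complex_mat A *\<^sub>v z) \<bullet>c z" and "q \<equiv> (complex_mat A *\<^sub>v z) \<bullet> z"
  shows "(complex_mat A *\<^sub>v x) \<bullet>c x =
    a * cnj a * p + b * cnj b * cnj p + a * cnj b * q + cnj (a * cnj b * q)"
proof -
  define y where "y = complex_mat A *\<^sub>v z"
  have cA: "complex_mat A \<in> carrier_mat n n" using A by auto
  have y: "y \<in> carrier_vec n" using cA z by (auto simp: y_def)
  have Ax: "complex_mat A *\<^sub>v x = a \<cdot>\<^sub>v y + b \<cdot>\<^sub>v conjugate y"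
    unfolding x_def using cA z complex_mat_mult_conjugate_vec[OF A z]
    by (simp add: mult_add_distrib_mat_vec[of _ n n] mult_mat_vec[of _ n n] y_def)
  have cx: "conjugate x = cnj a \<cdot>\<^sub>v conjugate z + cnj b \<cdot>\<^sub>v z"
    unfolding x_def using z by (intro eq_vecI) auto
  have "conjugate y \<bullet>c z = cnj (y \<bullet> z)" "conjugate y \<bullet> z = cnj (y \<bullet>c z)"
    using conjugate_sprod_vec[OF y z] conjugate_sprod_vec[OF y, of "conjugate z"] z by simp_all
  thus ?thesis
    unfolding Ax cx p_def q_def y_def[symmetric] using y z
    by (simp add: add_scalar_prod_distrib[of _ n] scalar_prod_add_distrib[of _ n] algebra_simps)
qed

text \<open>The values at \<open>(b, a)\<close> and \<open>(c, b)\<close> are \<open>a\<close> and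
  \<open>c\<close> times \<open>a * c - b\<^sup>2\<close>. If \<open>a\<close> and \<open>c\<close>
  both vanish, the value at \<open>(1, b)\<close> forces \<open>b = 0\<close>.\<close>

lemma quadratic_form_discriminant:
  fixes a b c :: real
  assumes nonneg: "\<And>x y. 0 \<le> a * x\<^sup>2 - 2 * b * x * y + c * y\<^sup>2"
  shows "b\<^sup>2 \<le> a * c"
proof -
  have a: "0 \<le> a" and c: "0 \<le> c" using nonneg[of 1 0] nonneg[of 0 1] by auto
  have 1: "0 \<le> a * (a * c - b\<^sup>2)"
    using nonneg[of b a] by (simp add: power2_eq_square algebra_simps)
  have 2: "0 \<le> c * (a * c - b\<^sup>2)"
    using nonneg[of c b] by (simp add: power2_eq_square algebra_simps)
  consider "a > 0" | "c > 0" | "a = 0" "c = 0" using a c by linarith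
  thus ?thesis
  proof cases
    case 3
    with nonneg[of 1 b] show ?thesis by (simp add: power2_eq_square)
  qed (use 1 2 in \<open>auto simp: zero_le_mult_iff\<close>)
qed

text \<open>On a suitable two-parameter family of combinations of \<open>z\<close> and its
  conjugate, \<open>Re\<close> and \<open>\<tau> * Re - Im\<close> of the form are real binary
  quadratic forms in the coefficients. The first, at \<open>(1, 1)\<close>, gives the bound on
  \<open>cmod q\<close>; the discriminant of the second gives the quadratic bound.\<close>

lemma real_matrix_form_bounds:
  fixes A :: "real mat" and z :: "complex vec"
  assumes A: "A \<in> carrier_mat n n" and z: "z \<in> carrier_vec n"
    and pos: "\<And>x. x \<in> carrier_vec n \<Longrightarrow> 0 \<le> Re ((complex_mat A *\<^sub>v x) \<bullet>c x)"
  defines "p \<equiv> (complex_mat A *\<^sub>v z) \<bullet>c z" and "q \<equiv> (complex_mat A *\<^sub>v z) \<bullet> z"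
  shows "cmod q \<le> Re p"
    and "\<And>\<tau>. (\<And>x. x \<in> carrier_vec n \<Longrightarrow>
        Im ((complex_mat A *\<^sub>v x) \<bullet>c x) \<le> \<tau> * Re ((complex_mat A *\<^sub>v x) \<bullet>c x)) \<Longrightarrow>
      \<bar>Im p\<bar> \<le> \<tau> * Re p \<and> (Im p)\<^sup>2 + (\<tau> * cmod q)\<^sup>2 \<le> (\<tau> * Re p)\<^sup>2"
proof -
  \<comment> \<open>This unimodular factor turns the cross term into \<open>- cmod q\<close>, its
    worst value; for \<open>q = 0\<close> any unit would serve.\<close>
  define u where "u = (if q = 0 then 1 else - cnj q / cmod q)"
  have "cnj q * q = cmod q * cmod q"
    using complex_norm_square[of q] by (simp add: power2_eq_square mult.commute)
  hence u: "cmod u = 1" "u * q = - cmod q"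
    by (auto simp: u_def norm_divide)
  have ucnj: "u * cnj u = 1" using u(1) by (simp flip: complex_norm_square)
  have form: "\<exists>x \<in> carrier_vec n.
      Re ((complex_mat A *\<^sub>v x) \<bullet>c x) = (\<alpha>\<^sup>2 + \<beta>\<^sup>2) * Re p - 2 * \<alpha> * \<beta> * cmod q \<and>
      Im ((complex_mat A *\<^sub>v x) \<bullet>c x) = (\<alpha>\<^sup>2 - \<beta>\<^sup>2) * Im p" for \<alpha> \<beta> :: real
  proof -
    define a where "a = of_real \<alpha> * u"
    define x where "x = a \<cdot>\<^sub>v z + of_real \<beta> \<cdot>\<^sub>v conjugate z"
    have "x \<in> carrier_vec n" using z by (auto simp: x_def)
    moreover have eq: "(complex_mat A *\<^sub>v x) \<bullet>c x = \<alpha>\<^sup>2 * p + \<beta>\<^sup>2 * cnj p - 2 * \<alpha> * \<beta> * cmod q"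
    proof -
      have 1: "a * cnj a = \<alpha>\<^sup>2" 
        using ucnj by (simp add: a_def power2_eq_square)
      have 2: "a * cnj (of_real \<beta>) * q = - (\<alpha> * \<beta> * cmod q)"
      proof -
        have "a * cnj (of_real \<beta>) * q = of_real \<alpha> * of_real \<beta> * (u * q)" by (simp add: a_def)
        thus ?thesis unfolding u(2) by simp
      qed
      show ?thesis
        unfolding x_def complex_mat_form_conjugate_pair[OF A z] p_def[symmetric] q_def[symmetric] 1 2
        by (simp add: power2_eq_square)
    qed
    ultimately show ?thesis by (intro bexI[of _ x]) (auto simp: eq algebra_simps simp flip: of_real_power)
  qed
  show "cmod q \<le> Re p"
    using form[of 1 1] pos by fastforce
  fix \<tau> assume \<tau>: "\<And>x. x \<in> carrier_vec n \<Longrightarrow>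
        Im ((complex_mat A *\<^sub>v x) \<bullet>c x) \<le> \<tau> * Re ((complex_mat A *\<^sub>v x) \<bullet>c x)"
  have "(\<tau> * cmod q)\<^sup>2 \<le> (\<tau> * Re p - Im p) * (\<tau> * Re p + Im p)"
  proof (rule quadratic_form_discriminant)
    fix \<alpha> \<beta> :: real
    obtain x where x: "x \<in> carrier_vec n"
      "Re ((complex_mat A *\<^sub>v x) \<bullet>c x) = (\<alpha>\<^sup>2 + \<beta>\<^sup>2) * Re p - 2 * \<alpha> * \<beta> * cmod q"
      "Im ((complex_mat A *\<^sub>v x) \<bullet>c x) = (\<alpha>\<^sup>2 - \<beta>\<^sup>2) * Im p" using form by blast
    show "0 \<le> (\<tau> * Re p - Im p) * \<alpha>\<^sup>2 - 2 * (\<tau> * cmod q) * \<alpha> * \<beta> + (\<tau> * Re p + Im p) * \<beta>\<^sup>2"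
      using \<tau>[OF x(1)] unfolding x(2,3) by (simp add: algebra_simps)
  qed
  moreover have "\<bar>Im p\<bar> \<le> \<tau> * Re p"
  proof -
    have "Im p \<le> \<tau> * Re p" using form[of 1 0] \<tau> by fastforce
    moreover have "- Im p \<le> \<tau> * Re p" using form[of 0 1] \<tau> by fastforce
    ultimately show ?thesis by linarith
  qed
  ultimately show "\<bar>Im p\<bar> \<le> \<tau> * Re p \<and> (Im p)\<^sup>2 + (\<tau> * cmod q)\<^sup>2 \<le> (\<tau> * Re p)\<^sup>2"
    by (simp add: power2_eq_square algebra_simps)
qed

text \<open>A kernel vector satisfies \<open>z = - R^T D w\<close> with \<open>w = R B z\<close>.
  Since \<open>R\<close> is real, its transpose can be moved across both the sesquilinear and the
  bilinear product, and only the former conjugates \<open>d\<close>.\<close>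

lemma singular_congruent_diagonal_forms:
  fixes R :: "real mat" and B M :: "complex mat"
  assumes R: "R \<in> carrier_mat n n" and B: "B \<in> carrier_mat n n"
    and M: "M = transpose_mat (complex_mat R) * mat_diag n d * complex_mat R"
    and sing: "det (1\<^sub>m n + M * B) = 0"
  obtains z w where "z \<in> carrier_vec n" "z \<noteq> 0\<^sub>v n"
    "(B *\<^sub>v z) \<bullet>c z = - (\<Sum>k<n. cnj (d k) * of_real ((cmod (w k))\<^sup>2))"
    "(B *\<^sub>v z) \<bullet> z = - (\<Sum>k<n. d k * (w k)\<^sup>2)"
proof -
  have cR: "complex_mat R \<in> carrier_mat n n" "transpose_mat (complex_mat R) \<in> carrier_mat n n" using R by auto
  define D where "D = mat_diag n d"
  have D: "D \<in> carrier_mat n n" by (simp add: D_def)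
  have Mc: "M \<in> carrier_mat n n" unfolding M D_def[symmetric] using cR D by auto
  have "1\<^sub>m n + M * B \<in> carrier_mat n n" using Mc B by auto
  from sing[unfolded det_0_iff_vec_prod_zero_field[OF this]] obtain z where
    z: "z \<in> carrier_vec n" "z \<noteq> 0\<^sub>v n" and 0: "(1\<^sub>m n + M * B) *\<^sub>v z = 0\<^sub>v n" by blast
  define y where "y = B *\<^sub>v z"
  define w where "w = complex_mat R *\<^sub>v y"
  define v where "v = D *\<^sub>v w"
  have y: "y \<in> carrier_vec n" using B z by (auto simp: y_def)
  have w: "w \<in> carrier_vec n" using cR y by (auto simp: w_def)
  have v: "v \<in> carrier_vec n" using D w by (auto simp: v_def)
  have vk: "v $ k = d k * w $ k" if "k < n" for k
    unfolding v_def D_def using w that by (simp add: mat_diag_mult_vec)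
  have "z + M *\<^sub>v y = 0\<^sub>v n"
    using 0 Mc B z by (simp add: add_mult_distrib_mat_vec[of _ n n] y_def)
  moreover have My: "M *\<^sub>v y = transpose_mat (complex_mat R) *\<^sub>v v"
    unfolding M D_def[symmetric] v_def w_def using cR D y by (simp add: assoc_mult_mat_vec[of _ n n _ n])
  ultimately have zv: "z = - (transpose_mat (complex_mat R) *\<^sub>v v)"
    using cR z by (intro eq_vecI) (auto simp: vec_eq_iff eq_neg_iff_add_eq_0)
  have Rt: "transpose_mat (complex_mat R) = complex_mat (transpose_mat R)" by auto
  have tc: "conjugate (transpose_mat (complex_mat R) *\<^sub>v v) = transpose_mat (complex_mat R) *\<^sub>v conjugate v"
    unfolding Rt using complex_mat_mult_conjugate_vec[of "transpose_mat R" n n v] R v by simp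
  have tr: "y \<bullet> (transpose_mat (complex_mat R) *\<^sub>v x) = w \<bullet> x" if x: "x \<in> carrier_vec n" for x
    using transpose_vec_mult_scalar[OF cR(2) x y] by (simp add: w_def)
  have "y \<bullet> z = - (w \<bullet> v)" unfolding zv using tr[OF v] y cR v by simp
  also have "\<dots> = - (\<Sum>k<n. d k * (w $ k)\<^sup>2)"
    using w v by (simp add: scalar_prod_def atLeast0LessThan vk power2_eq_square mult_ac)
  finally have q: "y \<bullet> z = \<dots>" .
  have "y \<bullet>c z = - (w \<bullet>c v)"
  proof -
    have "conjugate z = - (transpose_mat (complex_mat R) *\<^sub>v conjugate v)"
      unfolding zv tc[symmetric] by (intro eq_vecI) auto
    thus ?thesis using tr[of "conjugate v"] y cR v by simp
  qed
  also have "\<dots> = - (\<Sum>k<n. cnj (d k) * of_real ((cmod (w $ k))\<^sup>2))"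
    using w v by (simp add: scalar_prod_def atLeast0LessThan vk complex_norm_square mult_ac del: of_real_power)
  finally have p: "y \<bullet>c z = \<dots>" .
  show thesis by (rule that[of z "\<lambda>k. w $ k", folded y_def, OF z p q])
qed

section \<open>Inequalities for the phases\<close>

text \<open>Reverse triangle inequality, separating the term of the largest phase, which has index
  0, from all the others.\<close>

lemma cmod_sum_squares_ge:
  fixes w d :: "nat \<Rightarrow> complex"
  assumes "n \<noteq> 0" "\<And>k. cmod (d k) = 1"
  shows "(cmod (w 0))\<^sup>2 - (\<Sum>k\<in>{1..<n}. (cmod (w k))\<^sup>2) \<le> cmod (\<Sum>k<n. d k * (w k)\<^sup>2)"
proof -
  have "(\<Sum>k<n. d k * (w k)\<^sup>2) = d 0 * (w 0)\<^sup>2 + (\<Sum>k\<in>{1..<n}. d k * (w k)\<^sup>2)"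
    using assms(1) by (simp add: lessThan_atLeast0 sum.atLeast_Suc_lessThan)
  moreover have "cmod (\<Sum>k\<in>{1..<n}. d k * (w k)\<^sup>2) \<le> (\<Sum>k\<in>{1..<n}. (cmod (w k))\<^sup>2)"
    by (rule sum_norm_le) (simp add: norm_mult norm_power assms)
  moreover have "cmod (d 0 * (w 0)\<^sup>2) = (cmod (w 0))\<^sup>2"
    by (simp add: norm_mult norm_power assms)
  ultimately show ?thesis
    using norm_triangle_ineq4[of "d 0 * (w 0)\<^sup>2 + (\<Sum>k\<in>{1..<n}. d k * (w k)\<^sup>2)" "\<Sum>k\<in>{1..<n}. d k * (w k)\<^sup>2"]
    by simp
qed

text \<open>The difference of weights on the right is the one that
  \<open>cmod_sum_squares_ge\<close> compares with the modulus of \<open>q\<close>. It is used with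
  \<open>s = - cos (\<mu> 1)\<close> and with \<open>s = sin \<delta>\<close>.\<close>

lemma weighted_sum_le_dominant:
  fixes r c :: "nat \<Rightarrow> real"
  assumes "n \<noteq> 0" "\<And>k. 0 \<le> r k" "c 0 \<le> s" "\<And>k. k \<in> {1..<n} \<Longrightarrow> c k \<le> - s"
  shows "(\<Sum>k<n. c k * r k) \<le> s * (r 0 - (\<Sum>k\<in>{1..<n}. r k))"
proof -
  have "(\<Sum>k<n. c k * r k) = c 0 * r 0 + (\<Sum>k\<in>{1..<n}. c k * r k)"
    using assms(1) by (simp add: lessThan_atLeast0 sum.atLeast_Suc_lessThan)
  also have "\<dots> \<le> s * r 0 + (\<Sum>k\<in>{1..<n}. - s * r k)"
    using assms by (intro add_mono sum_mono mult_right_mono) auto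
  finally show ?thesis by (simp add: sum_negf sum_distrib_left algebra_simps)
qed

lemma cos_ge_cos_of_abs_le: "\<bar>x\<bar> \<le> y \<Longrightarrow> y \<le> pi \<Longrightarrow> cos y \<le> cos (x :: real)"
  using cos_monotone_0_pi_le[of "\<bar>x\<bar>" y] by simp

locale phase_tuple =
  fixes n :: nat and \<mu> :: "nat \<Rightarrow> real"
  assumes n: "n \<ge> 2" and mono: "antimono_on {1..n} \<mu>" and gap: "\<mu> 1 - \<mu> n < pi"
    and upper: "\<mu> 1 < pi" and lower: "- pi / 2 < \<mu> n"
begin

text \<open>Summation indices start at 0, so \<open>k \<ge> 1\<close> ranges over the phases from
  the second to the last.\<close>

lemma phase_bounds:
  assumes "k \<in> {1..<n}"
  shows "\<mu> (Suc k) \<le> \<mu> 2" "\<mu> 1 - pi < \<mu> (Suc k)" "- pi / 2 < \<mu> (Suc k)" "\<mu> 2 \<le> \<mu> 1"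
proof -
  have "\<mu> (Suc k) \<le> \<mu> 2" "\<mu> n \<le> \<mu> (Suc k)" "\<mu> 2 \<le> \<mu> 1"
    using assms n by (auto intro!: monotone_onD[OF mono])
  thus "\<mu> (Suc k) \<le> \<mu> 2" "\<mu> 1 - pi < \<mu> (Suc k)" "- pi / 2 < \<mu> (Suc k)" "\<mu> 2 \<le> \<mu> 1"
    using gap lower by linarith+
qed

lemma second_phase_bounds: "\<mu> 2 \<le> \<mu> 1" "\<mu> 1 - pi < \<mu> 2"
  using phase_bounds[of 1] n by (auto simp: numeral_2_eq_2)

text \<open>For squared moduli \<open>r k\<close> the left side is \<open>Re p\<close>. Its
  positivity forces \<open>\<mu> 1\<close> beyond \<open>pi / 2\<close>; all other phases then lie
  within \<open>pi - \<mu> 1\<close> of zero, so their cosines are at least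
  \<open>- cos (\<mu> 1)\<close> and the first weight has to dominate.\<close>

lemma cosine_sum_bound:
  fixes r :: "nat \<Rightarrow> real"
  assumes r: "\<And>k. 0 \<le> r k" and sum: "\<mu> 1 + \<mu> 2 \<le> pi"
    and p: "0 < - (\<Sum>k<n. cos (\<mu> (Suc k)) * r k)"
  shows "- (\<Sum>k<n. cos (\<mu> (Suc k)) * r k) < r 0 - (\<Sum>k\<in>{1..<n}. r k)"
proof -
  \<comment> \<open>Otherwise all phases would lie between \<open>- pi / 2\<close> and
    \<open>pi / 2\<close>, every cosine would be nonnegative, and \<open>p\<close> would
    fail.\<close>
  have 1: "cos (\<mu> 1) < 0"
  proof (rule ccontr)
    assume neg: "\<not> cos (\<mu> 1) < 0"
    have le: "\<mu> 1 \<le> pi / 2"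
    proof (rule ccontr)
      assume "\<not> \<mu> 1 \<le> pi / 2"
      hence "cos (\<mu> 1) < cos (pi / 2)" using upper by (intro cos_monotone_0_pi) auto
      with neg show False by simp
    qed
    have "0 \<le> cos (\<mu> (Suc k))" if "k < n" for k
    proof -
      have "\<mu> n \<le> \<mu> (Suc k)" "\<mu> (Suc k) \<le> \<mu> 1"
        using that n by (auto intro!: monotone_onD[OF mono])
      thus ?thesis using le lower by (intro cos_ge_zero) auto
    qed
    hence "0 \<le> (\<Sum>k<n. cos (\<mu> (Suc k)) * r k)" using r by (intro sum_nonneg) auto
    with p show False by simp
  qed
  have "- cos (\<mu> (Suc k)) \<le> cos (\<mu> 1)" if "k \<in> {1..<n}" for k
  proof -
    \<comment> \<open>The sum condition bounds the phase above by \<open>pi - \<mu> 1\<close>, and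
      the sectorial gap bounds it below by \<open>\<mu> 1 - pi\<close>.\<close>
    have "cos (pi - \<mu> 1) \<le> cos (\<mu> (Suc k))"
    proof (rule cos_ge_cos_of_abs_le)
      have "0 \<le> \<mu> 1"
      proof (rule ccontr)
        assume "\<not> 0 \<le> \<mu> 1"
        moreover have "- pi / 2 < \<mu> 1" using phase_bounds[OF that] by linarith
        ultimately have "0 < cos (\<mu> 1)" by (intro cos_gt_zero_pi) auto
        with 1 show False by simp
      qed
      thus "pi - \<mu> 1 \<le> pi" by simp
      show "\<bar>\<mu> (Suc k)\<bar> \<le> pi - \<mu> 1" using phase_bounds[OF that] sum by linarith
    qed
    thus ?thesis by simp
  qed
  hence "(\<Sum>k<n. - cos (\<mu> (Suc k)) * r k) \<le> - cos (\<mu> 1) * (r 0 - (\<Sum>k\<in>{1..<n}. r k))"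
    using n r by (intro weighted_sum_le_dominant) auto
  hence le: "- (\<Sum>k<n. cos (\<mu> (Suc k)) * r k) \<le> - cos (\<mu> 1) * (r 0 - (\<Sum>k\<in>{1..<n}. r k))"
    by (simp add: sum_negf)
  with p have "0 < - cos (\<mu> 1) * (r 0 - (\<Sum>k\<in>{1..<n}. r k))" by linarith
  hence 2: "0 < r 0 - (\<Sum>k\<in>{1..<n}. r k)" by (rule zero_less_mult_pos) (use 1 in simp)
  \<comment> \<open>Strictness comes from \<open>\<mu> 1 < pi\<close>; the contradiction in
    \<open>no_singular_perturbation\<close> rests on it.\<close>
  have "cos pi < cos (\<mu> 1)"
    using phase_bounds[of 1] n sum upper second_phase_bounds 1
    by (intro cos_monotone_0_pi) (auto, smt (verit) cos_gt_zero_pi)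
  hence "- cos (\<mu> 1) * (r 0 - (\<Sum>k\<in>{1..<n}. r k)) < r 0 - (\<Sum>k\<in>{1..<n}. r k)"
    using mult_strict_right_mono[OF _ 2, of "- cos (\<mu> 1)" 1] by simp
  with le show ?thesis by linarith
qed

text \<open>The angle \<open>\<sigma>\<close> makes the coefficients of the first two phases opposite; this is the linear
  functional for which the Cauchy-Schwarz step in \<open>tangent_bound_of_forms\<close> is sharp at the optimum.\<close>

lemma sine_sum_bound:
  fixes r :: "nat \<Rightarrow> real"
  assumes r: "\<And>k. 0 \<le> r k"
  defines "\<sigma> \<equiv> (\<mu> 1 + \<mu> 2) / 2" and "\<delta> \<equiv> (\<mu> 1 - \<mu> 2) / 2"
  shows "(\<Sum>k<n. sin (\<mu> (Suc k) - \<sigma>) * r k) \<le> sin \<delta> * (r 0 - (\<Sum>k\<in>{1..<n}. r k))"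
proof (rule weighted_sum_le_dominant)
  have "\<mu> 1 - \<sigma> = \<delta>" by (simp add: \<sigma>_def \<delta>_def field_simps)
  thus "sin (\<mu> (Suc 0) - \<sigma>) \<le> sin \<delta>" by simp
  fix k assume k: "k \<in> {1..<n}"
  note b = phase_bounds[OF k]
  \<comment> \<open>The angle \<open>\<sigma> - \<mu> (Suc k)\<close> lies between
    \<open>\<delta>\<close> and \<open>pi - \<delta>\<close>, where the sine is at least
    \<open>sin \<delta>\<close>. Measured from \<open>pi / 2\<close>, this becomes a single bound on
    an absolute value.\<close>
  have "cos (pi / 2 - \<delta>) \<le> cos (\<sigma> - \<mu> (Suc k) - pi / 2)"
  proof (rule cos_ge_cos_of_abs_le)
    show "\<bar>\<sigma> - \<mu> (Suc k) - pi / 2\<bar> \<le> pi / 2 - \<delta>" "pi / 2 - \<delta> \<le> pi"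
      unfolding \<sigma>_def \<delta>_def using b by (simp_all add: abs_le_iff field_simps)
  qed
  hence "sin \<delta> \<le> sin (\<sigma> - \<mu> (Suc k))" by (simp add: cos_diff)
  thus "sin (\<mu> (Suc k) - \<sigma>) \<le> - sin \<delta>"
    by (metis minus_diff_eq neg_le_iff_le sin_minus)
qed (use n r in auto)

end

text \<open>Here \<open>P\<close>, \<open>I\<close>, \<open>Q\<close> stand for \<open>Re p\<close>,
  \<open>Im p\<close>, \<open>cmod q\<close>. The linear inequality is multiplied by
  \<open>\<tau>\<close> and squared, Cauchy-Schwarz brings in the left side of \<open>disc\<close>,
  and \<open>(\<tau> * P)\<^sup>2\<close> cancels. For \<open>\<tau> = 0\<close> there is nothing to
  cancel, but then \<open>I = 0\<close> and \<open>Q \<le> P\<close> suffices.\<close>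

lemma tangent_bound_of_forms:
  fixes P I Q \<tau> \<sigma> S :: real
  assumes P: "0 < P" and Q: "0 \<le> Q" "Q \<le> P" and \<tau>: "0 \<le> \<tau>"
    and disc: "I\<^sup>2 + (\<tau> * Q)\<^sup>2 \<le> (\<tau> * P)\<^sup>2"
    and S: "0 \<le> S" and \<sigma>: "0 \<le> sin \<sigma>"
    and lin: "P * sin \<sigma> + I * cos \<sigma> \<le> S * Q"
  shows "(sin \<sigma>)\<^sup>2 - S\<^sup>2 \<le> (cos \<sigma>)\<^sup>2 * \<tau>\<^sup>2"
proof (cases "\<tau> = 0")
  case True
  hence "I = 0" using disc by simp
  hence "P * sin \<sigma> \<le> S * Q" using lin by simp
  also have "\<dots> \<le> S * P" by (rule mult_left_mono[OF Q(2) S])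
  finally have "P * sin \<sigma> \<le> S * P" .
  hence "sin \<sigma> \<le> S" using P by (simp add: mult.commute)
  hence "(sin \<sigma>)\<^sup>2 \<le> S\<^sup>2" using \<sigma> by (rule power_mono)
  thus ?thesis using True by simp
next
  case False
  have "\<tau> * (P * sin \<sigma>) \<le> \<tau> * (S * Q - cos \<sigma> * I)"
    using lin \<tau> by (intro mult_left_mono) (auto simp: mult.commute)
  hence "(\<tau> * (P * sin \<sigma>))\<^sup>2 \<le> (\<tau> * (S * Q - cos \<sigma> * I))\<^sup>2"
    using \<tau> P \<sigma> by (intro power_mono) auto
  also have "\<dots> = (S * (\<tau> * Q) + (- cos \<sigma> * \<tau>) * I)\<^sup>2" by (simp add: algebra_simps)
  also have "\<dots> \<le> (S\<^sup>2 + (cos \<sigma> * \<tau>)\<^sup>2) * (I\<^sup>2 + (\<tau> * Q)\<^sup>2)"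
    \<comment> \<open>This square is the defect in Cauchy-Schwarz for the vectors
      \<open>(S, - cos \<sigma> * \<tau>)\<close> and \<open>(\<tau> * Q, I)\<close>.\<close>
    using zero_le_power2[of "S * I + (cos \<sigma> * \<tau>) * (\<tau> * Q)"] by (simp add: power2_eq_square algebra_simps)
  also have "\<dots> \<le> (S\<^sup>2 + (cos \<sigma> * \<tau>)\<^sup>2) * (\<tau> * P)\<^sup>2"
    using disc by (intro mult_left_mono) auto
  finally have "(sin \<sigma>)\<^sup>2 * (\<tau> * P)\<^sup>2 \<le> (S\<^sup>2 + (cos \<sigma> * \<tau>)\<^sup>2) * (\<tau> * P)\<^sup>2"
    by (simp add: power_mult_distrib mult_ac)
  hence "(sin \<sigma>)\<^sup>2 \<le> S\<^sup>2 + (cos \<sigma> * \<tau>)\<^sup>2" using P False by (simp add: mult_le_cancel_right)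
  thus ?thesis by (simp add: power_mult_distrib)
qed

section \<open>Sectorial real matrices and rotations\<close>

lemma symmetric_part_form:
  fixes A :: "real mat"
  assumes A: "A \<in> carrier_mat n n" and x: "x \<in> carrier_vec n"
  shows "((A + transpose_mat A) *\<^sub>v x) \<bullet> x = 2 * ((A *\<^sub>v x) \<bullet> x)"
proof -
  have "(transpose_mat A *\<^sub>v x) \<bullet> x = (A *\<^sub>v x) \<bullet> x"
    using transpose_vec_mult_scalar[OF A x x] comm_scalar_prod[OF x, of "A *\<^sub>v x"] A x by simp
  thus ?thesis using A x
    by (simp add: add_mult_distrib_mat_vec[of _ n n] add_scalar_prod_distrib[of _ n])
qed

lemma hermitian_part_form:
  fixes A :: "real mat"
  assumes A: "A \<in> carrier_mat n n" and x: "x \<in> carrier_vec n"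
  shows "(hermitian_part A *\<^sub>v x) \<bullet> x = (A *\<^sub>v x) \<bullet> x"
proof -
  have "hermitian_part A *\<^sub>v x = (1 / 2) \<cdot>\<^sub>v ((A + transpose_mat A) *\<^sub>v x)"
    unfolding hermitian_part_def using A x
    by (intro eq_vecI) (auto simp: scalar_prod_def sum_distrib_left mult.assoc intro!: sum.cong)
  thus ?thesis using symmetric_part_form[OF A x] A x by simp
qed

lemma positive_definite_real_iff:
  fixes A B :: "real mat"
  assumes "B \<in> carrier_mat n n" "transpose_mat B = B"
  shows "positive_definite B \<longleftrightarrow> (\<forall>x \<in> carrier_vec n. x \<noteq> 0\<^sub>v n \<longrightarrow> 0 < (B *\<^sub>v x) \<bullet> x)"
  using assms unfolding positive_definite_def by auto

lemma positive_definite_hermitian_part_iff: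
  fixes A :: "real mat"
  assumes A: "A \<in> carrier_mat n n"
  shows "positive_definite (hermitian_part A) \<longleftrightarrow>
    (\<forall>x \<in> carrier_vec n. x \<noteq> 0\<^sub>v n \<longrightarrow> 0 < (A *\<^sub>v x) \<bullet> x)"
proof -
  have "hermitian_part A \<in> carrier_mat n n" "transpose_mat (hermitian_part A) = hermitian_part A"
    using A by (simp add: hermitian_part_def, intro eq_matI, auto simp: hermitian_part_def)
  from positive_definite_real_iff[OF this] show ?thesis using A by (simp add: hermitian_part_form)
qed

lemma positive_definite_symmetric_part_iff:
  fixes A :: "real mat"
  assumes A: "A \<in> carrier_mat n n"
  shows "positive_definite (A + transpose_mat A) \<longleftrightarrow>
    (\<forall>x \<in> carrier_vec n. x \<noteq> 0\<^sub>v n \<longrightarrow> 0 < (A *\<^sub>v x) \<bullet> x)"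
proof -
  have 1: "A + transpose_mat A \<in> carrier_mat n n" using A by auto
  have 2: "transpose_mat (A + transpose_mat A) = A + transpose_mat A"
    by (rule eq_matI) (use A in auto)
  show ?thesis
    unfolding positive_definite_real_iff[OF 1 2] by (auto simp: symmetric_part_form[OF A])
qed

text \<open>For real \<open>A\<close> the real part of the form at \<open>u + \<i> v\<close> is the
  sum of the real forms at \<open>u\<close> and \<open>v\<close>; the cross terms are purely
  imaginary.\<close>

lemma complex_form_Re_pos:
  fixes A :: "real mat"
  assumes A: "A \<in> carrier_mat n n" and z: "z \<in> carrier_vec n" "z \<noteq> 0\<^sub>v n"
    and pos: "\<And>x. x \<in> carrier_vec n \<Longrightarrow> x \<noteq> 0\<^sub>v n \<Longrightarrow> 0 < (A *\<^sub>v x) \<bullet> x"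
  shows "0 < Re ((complex_mat A *\<^sub>v z) \<bullet>c z)"
proof -
  define u where "u = map_vec Re z"
  define v where "v = map_vec Im z"
  have uv: "u \<in> carrier_vec n" "v \<in> carrier_vec n" using z by (auto simp: u_def v_def)
  have "Re ((complex_mat A *\<^sub>v z) \<bullet>c z) = (A *\<^sub>v u) \<bullet> u + (A *\<^sub>v v) \<bullet> v"
  proof -
    have "Re ((complex_mat A *\<^sub>v z) $ i) = (A *\<^sub>v u) $ i"
      "Im ((complex_mat A *\<^sub>v z) $ i) = (A *\<^sub>v v) $ i" if "i < n" for i
      using A z that by (simp_all add: scalar_prod_def u_def v_def)
    hence "Re ((complex_mat A *\<^sub>v z) $ i * cnj (z $ i)) = (A *\<^sub>v u) $ i * u $ i + (A *\<^sub>v v) $ i * v $ i"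
      if "i < n" for i
      using z that by (simp add: u_def v_def)
    hence "(\<Sum>i\<in>{0..<n}. Re ((complex_mat A *\<^sub>v z) $ i * cnj (z $ i))) =
        (\<Sum>i\<in>{0..<n}. (A *\<^sub>v u) $ i * u $ i + (A *\<^sub>v v) $ i * v $ i)"
      by (intro sum.cong) auto
    thus ?thesis
      using z uv unfolding scalar_prod_def[of _ "conjugate z"] scalar_prod_def[of _ u] scalar_prod_def[of _ v] Re_sum
      by (simp add: sum.distrib)
  qed
  moreover have nonneg: "0 \<le> (A *\<^sub>v x) \<bullet> x" if "x \<in> carrier_vec n" for x
    using pos[OF that] A that by (cases "x = 0\<^sub>v n") auto
  moreover have "u \<noteq> 0\<^sub>v n \<or> v \<noteq> 0\<^sub>v n"
    using z by (auto simp: u_def v_def vec_eq_iff complex_eq_iff)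
  ultimately show ?thesis
    using pos[OF uv(1)] pos[OF uv(2)] nonneg[OF uv(1)] nonneg[OF uv(2)] by linarith
qed

text \<open>The form is a nonnegative combination of the \<open>cis (\<phi> k)\<close>, which lie in
  the right half plane and have slope at most \<open>tan (\<phi> 1)\<close>. This translates the
  largest phase into a condition on the numerical range.\<close>

lemma sectorial_form:
  assumes sec: "sectorial_with_phases n A \<phi>" and \<phi>: "\<And>i. i \<in> {1..n} \<Longrightarrow> \<phi> i \<in> {- pi / 2 <..< pi / 2}"
    and x: "x \<in> carrier_vec n"
  shows "x \<noteq> 0\<^sub>v n \<Longrightarrow> 0 < Re ((A *\<^sub>v x) \<bullet>c x)"
    and "Im ((A *\<^sub>v x) \<bullet>c x) \<le> tan (\<phi> 1) * Re ((A *\<^sub>v x) \<bullet>c x)"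
proof -
  from sec obtain T where T: "T \<in> carrier_mat n n" "invertible_mat T"
    and A: "A = mat_adjoint T * mat_diag n (\<lambda>i. cis (\<phi> (Suc i))) * T"
    and mono: "antimono_on {1..n} \<phi>"
    unfolding sectorial_with_phases_def by blast
  have cos: "0 < cos (\<phi> (Suc k))" if "k < n" for k
    using \<phi>[of "Suc k"] that by (intro cos_gt_zero_pi) auto
  show "x \<noteq> 0\<^sub>v n \<Longrightarrow> 0 < Re ((A *\<^sub>v x) \<bullet>c x)"
    unfolding A using cos by (intro diagonal_form_Re_pos T x) auto
  define r where "r k = (cmod ((T *\<^sub>v x) $ k))\<^sup>2" for k
  have form: "(A *\<^sub>v x) \<bullet>c x = (\<Sum>k<n. cis (\<phi> (Suc k)) * of_real (r k))"
    unfolding A diagonal_form[OF T(1) x] r_def by (simp add: complex_norm_square del: of_real_power)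
  have "(\<Sum>k<n. sin (\<phi> (Suc k)) * r k) \<le> (\<Sum>k<n. tan (\<phi> 1) * (cos (\<phi> (Suc k)) * r k))"
  proof (rule sum_mono)
    fix k assume "k \<in> {..<n}"
    hence k: "k < n" by simp
    have "\<phi> (Suc k) \<le> \<phi> 1" using k by (auto intro!: monotone_onD[OF mono])
    hence "tan (\<phi> (Suc k)) \<le> tan (\<phi> 1)"
      using \<phi>[of "Suc k"] \<phi>[of 1] k by (intro tan_mono_le) auto
    hence "tan (\<phi> (Suc k)) * (cos (\<phi> (Suc k)) * r k) \<le> tan (\<phi> 1) * (cos (\<phi> (Suc k)) * r k)"
      using cos[OF k] by (intro mult_right_mono) (auto simp: r_def)
    thus "sin (\<phi> (Suc k)) * r k \<le> tan (\<phi> 1) * (cos (\<phi> (Suc k)) * r k)"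
      using cos[OF k] by (simp add: tan_def)
  qed
  thus "Im ((A *\<^sub>v x) \<bullet>c x) \<le> tan (\<phi> 1) * Re ((A *\<^sub>v x) \<bullet>c x)"
    by (simp add: form sum_distrib_left)
qed

lemma sectorial_imp_positive_definite:
  fixes A :: "real mat"
  assumes A: "A \<in> carrier_mat n n" and sec: "sectorial_with_phases n (complex_mat A) \<phi>"
    and \<phi>: "\<And>i. i \<in> {1..n} \<Longrightarrow> \<phi> i \<in> {- pi / 2 <..< pi / 2}"
  shows "positive_definite (hermitian_part A)"
  unfolding positive_definite_hermitian_part_iff[OF A]
proof (intro ballI impI)
  fix x :: "real vec" assume x: "x \<in> carrier_vec n" "x \<noteq> 0\<^sub>v n"
  have cx: "map_vec complex_of_real x \<in> carrier_vec n" "map_vec complex_of_real x \<noteq> 0\<^sub>v n"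
    using x by (auto simp: vec_eq_iff)
  from sectorial_form(1)[OF sec \<phi> cx] show "0 < (A *\<^sub>v x) \<bullet> x"
    unfolding complex_mat_form[OF A x(1)] by simp
qed

lemma mat_adjoint_mult:
  assumes "A \<in> carrier_mat n m" "B \<in> carrier_mat m l"
  shows "mat_adjoint (A * B :: complex mat) = mat_adjoint B * mat_adjoint A"
  using assms by (intro eq_matI) (auto simp: scalar_prod_def mult.commute intro!: sum.cong)

lemma invertible_matI:
  fixes A :: "'a :: field mat"
  assumes "A \<in> carrier_mat n n" "B \<in> carrier_mat n n" "A * B = 1\<^sub>m n"
  shows "invertible_mat A"
  using assms mat_mult_left_right_inverse[OF assms] unfolding invertible_mat_def inverts_mat_def by auto

section \<open>Plane rotations as extremal perturbations\<close>

definition rotation_block :: "nat \<Rightarrow> real \<Rightarrow> real mat" where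
  "rotation_block n \<theta> = mat n n (\<lambda>(i,j).
     if i = 0 \<and> j = 0 \<or> i = 1 \<and> j = 1 then cos \<theta>
     else if i = 0 \<and> j = 1 then - sin \<theta> else if i = 1 \<and> j = 0 then sin \<theta>
     else if i = j then 1 else 0)"

definition rotation_phases :: "nat \<Rightarrow> real \<Rightarrow> nat \<Rightarrow> real" where
  "rotation_phases n \<theta> i = (if i = 1 then \<theta> else if i = n then - \<theta> else 0)"

text \<open>The eigenvectors of the rotation occupy the first and the last row because the phases
  \<open>\<theta>, 0, \<dots>, 0, - \<theta>\<close> have to decrease.\<close>

definition rotation_eigenbasis :: "nat \<Rightarrow> complex mat" where
  "rotation_eigenbasis n = mat n n (\<lambda>(k,j).
     if k = 0 then (if j = 0 then 1 / sqrt 2 else if j = 1 then \<i> / sqrt 2 else 0)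
     else if k = n - 1 then (if j = 0 then 1 / sqrt 2 else if j = 1 then - \<i> / sqrt 2 else 0)
     else if j = k + 1 then 1 else 0)"

text \<open>Columns 0 and \<open>n - 1\<close> of the adjoint are the eigenvectors
  \<open>(1, - \<i>)\<close> and \<open>(1, \<i>)\<close> over \<open>sqrt 2\<close> of the
  rotation, for \<open>cis \<theta>\<close> and \<open>cis (- \<theta>)\<close>, extended by zeros;
  the columns between them are fixed unit vectors.\<close>

lemma rotation_eigenbasis_diagonal:
  assumes n: "n \<ge> 2"
  shows "mat_adjoint (rotation_eigenbasis n) * mat_diag n (\<lambda>i. cis (rotation_phases n \<theta> (Suc i))) *
    rotation_eigenbasis n = complex_mat (rotation_block n \<theta>)" (is "?L = ?R")
proof (rule eq_matI)
  let ?V = "rotation_eigenbasis n"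
  let ?d = "\<lambda>k. cis (rotation_phases n \<theta> (Suc k))"
  have V: "?V \<in> carrier_mat n n" by (simp add: rotation_eigenbasis_def)
  show dim: "dim_row ?L = dim_row ?R" "dim_col ?L = dim_col ?R"
    using V by (auto simp: rotation_block_def)
  fix i j assume "i < dim_row ?R" "j < dim_col ?R"
  hence ij: "i < n" "j < n" by (auto simp: rotation_block_def)
  define g where "g k = cnj (?V $$ (k,i)) * ?d k * ?V $$ (k,j)" for k
  have "?L $$ (i,j) = (\<Sum>k<n. g k)"
    using V ij mat_adjoint_carrier[OF V] by (subst index_mult_mat_diag[of _ n n]) (auto simp: g_def)
  also have "\<dots> = g 0 + (g (n - 1) + (\<Sum>k\<in>{1..<n - 1}. g k))"
  proof -
    have "{..<n} = insert 0 (insert (n - 1) {1..<n - 1})" "0 \<noteq> n - 1" using n by auto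
    thus ?thesis by simp
  qed
  \<comment> \<open>Row \<open>k\<close> strictly between the first and the last is the unit vector
    of index \<open>k + 1\<close>, so it contributes only to the diagonal entry
    \<open>i = k + 1\<close>. For \<open>i < 2\<close> the truncated \<open>i - 1\<close> is 0,
    outside the range.\<close>
  also have "(\<Sum>k\<in>{1..<n - 1}. g k) = (\<Sum>k\<in>{1..<n - 1}. if k = i - 1 then (if i = j \<and> i \<ge> 2 then 1 else 0) else 0)"
  proof (rule sum.cong[OF refl])
    fix k assume "k \<in> {1..<n - 1}"
    hence k: "k \<noteq> 0" "k \<noteq> n - 1" "Suc k \<noteq> 1" "Suc k \<noteq> n" "k < n" by auto
    have V: "?V $$ (k,l) = (if l = k + 1 then 1 else 0)" if "l < n" for l
      using k that by (simp add: rotation_eigenbasis_def)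
    have "g k = cnj (if i = k + 1 then 1 else 0) * (if j = k + 1 then 1 else 0)"
      unfolding g_def V[OF ij(1)] V[OF ij(2)] using k by (simp add: rotation_phases_def)
    thus "g k = (if k = i - 1 then (if i = j \<and> i \<ge> 2 then 1 else 0) else 0)"
      using k by auto
  qed
  also have "\<dots> = (if i = j \<and> i \<ge> 2 then 1 else 0)"
    using ij by (auto simp: sum.delta)
  also have "g 0 = cnj (?V $$ (0,i)) * cis \<theta> * ?V $$ (0,j)"
    by (simp add: g_def rotation_phases_def)
  also have "g (n - 1) = cnj (?V $$ (n - 1,i)) * cis (- \<theta>) * ?V $$ (n - 1,j)"
    using n by (simp add: g_def rotation_phases_def)
  also have "cnj (?V $$ (0,i)) * cis \<theta> * ?V $$ (0,j) + (cnj (?V $$ (n - 1,i)) * cis (- \<theta>) * ?V $$ (n - 1,j) +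
      (if i = j \<and> i \<ge> 2 then 1 else 0)) = ?R $$ (i,j)"
  proof -
    define s where "s = 1 / sqrt 2"
    have s: "s * (s * x) = x / 2" for x :: real by (simp add: s_def)
    have V0: "?V $$ (0,l) = (if l = 0 then of_real s else if l = 1 then \<i> * of_real s else 0)"
      and Vn: "?V $$ (n - 1,l) = (if l = 0 then of_real s else if l = 1 then - \<i> * of_real s else 0)"
      if "l < n" for l
      using n that by (simp_all add: rotation_eigenbasis_def s_def of_real_divide)
    have R: "?R $$ (i,j) = of_real (rotation_block n \<theta> $$ (i,j))"
      using ij by (simp add: rotation_block_def)
    show ?thesis
      unfolding V0[OF ij(1)] V0[OF ij(2)] Vn[OF ij(1)] Vn[OF ij(2)] R
      using ij n by (simp add: rotation_block_def complex_eq_iff s mult.left_commute mult.commute[of _ s])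
  qed
  finally show "?L $$ (i,j) = ?R $$ (i,j)" .
qed

text \<open>Congruence by a real invertible matrix keeps the phases: its transpose is absorbed into
  the factor \<open>T\<close> next to the unitary eigenbasis.\<close>

lemma rotation_congruence_sectorial:
  fixes R R' :: "real mat"
  assumes n: "n \<ge> 2" and \<theta>: "0 \<le> \<theta>" "\<theta> < pi / 2"
    and R: "R \<in> carrier_mat n n" "R' \<in> carrier_mat n n" "R * R' = 1\<^sub>m n"
  shows "sectorial_with_phases n (complex_mat (R' * rotation_block n \<theta> * transpose_mat R')) (rotation_phases n \<theta>)"
proof -
  define V where "V = rotation_eigenbasis n"
  define D where "D = mat_diag n (\<lambda>i. cis (rotation_phases n \<theta> (Suc i)))"
  define G where "G = complex_mat (rotation_block n \<theta>)"
  define S where "S = complex_mat R'"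
  define S' where "S' = complex_mat R"
  have c: "V \<in> carrier_mat n n" "D \<in> carrier_mat n n" "G \<in> carrier_mat n n"
    "S \<in> carrier_mat n n" "S' \<in> carrier_mat n n" "mat_adjoint V \<in> carrier_mat n n"
    using R mat_adjoint_carrier[of V n n]
    by (auto simp: V_def D_def G_def S_def S'_def rotation_eigenbasis_def rotation_block_def)
  have ct: "transpose_mat S \<in> carrier_mat n n" "transpose_mat S' \<in> carrier_mat n n" using c by auto
  have G: "mat_adjoint V * D * V = G"
    unfolding V_def D_def G_def by (rule rotation_eigenbasis_diagonal[OF n])
  \<comment> \<open>At angle 0 both the rotation and its diagonal form are the identity, so the
    diagonalization itself shows that \<open>V\<close> is unitary.\<close>
  have "rotation_phases n 0 = (\<lambda>_. 0)" "complex_mat (rotation_block n 0) = 1\<^sub>m n"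
    by (auto simp: rotation_phases_def rotation_block_def intro!: eq_matI)
  hence "mat_adjoint V * V = 1\<^sub>m n"
    using rotation_eigenbasis_diagonal[OF n, of 0] c by (simp add: V_def)
  hence VV: "V * mat_adjoint V = 1\<^sub>m n" by (rule mat_mult_left_right_inverse[OF c(6,1)])
  have SS: "S' * S = 1\<^sub>m n"
    using complex_mat_mult[OF R(1,2)] R(3) by (simp add: S_def S'_def of_real_hom.mat_hom_one)
  have SSt: "transpose_mat S * transpose_mat S' = 1\<^sub>m n"
    using transpose_mult[OF c(5,4)] SS by simp
  define T where "T = V * transpose_mat S"
  have T: "T \<in> carrier_mat n n" using c ct by (auto simp: T_def)
  have "T * (transpose_mat S' * mat_adjoint V) = V * (transpose_mat S * transpose_mat S') * mat_adjoint V"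
    unfolding T_def using c ct by (simp add: assoc_mult_mat[of _ n n _ n _ n])
  also have "\<dots> = 1\<^sub>m n" using SSt VV c by simp
  finally have inv: "invertible_mat T"
    using c ct by (intro invertible_matI[OF T]) auto
  have "mat_adjoint (transpose_mat S) = S" unfolding S_def by (rule eq_matI) auto
  hence Ta: "mat_adjoint T = S * mat_adjoint V"
    unfolding T_def using mat_adjoint_mult[OF c(1) ct(1)] by simp
  have "mat_adjoint T * D * T = S * (mat_adjoint V * D * V) * transpose_mat S"
    unfolding Ta unfolding T_def using c ct by (simp add: assoc_mult_mat[of _ n n _ n _ n])
  also have "\<dots> = S * G * transpose_mat S" unfolding G ..
  also have "transpose_mat S = complex_mat (transpose_mat R')" unfolding S_def by auto
  also have "S * G * \<dots> = complex_mat (R' * rotation_block n \<theta> * transpose_mat R')"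
  proof -
    have "rotation_block n \<theta> \<in> carrier_mat n n" by (simp add: rotation_block_def)
    thus ?thesis unfolding S_def G_def using R by (simp add: complex_mat_mult[of _ n n _ n])
  qed
  finally have eq: "complex_mat (R' * rotation_block n \<theta> * transpose_mat R') = mat_adjoint T * D * T" ..
  have "antimono_on {1..n} (rotation_phases n \<theta>)"
    using \<theta> by (intro monotone_onI) (auto simp: rotation_phases_def)
  moreover have "rotation_phases n \<theta> 1 - rotation_phases n \<theta> n < pi"
    using \<theta> n by (simp add: rotation_phases_def)
  ultimately show ?thesis
    unfolding sectorial_with_phases_def using T inv eq unfolding D_def by blast
qed

text \<open>The equation on \<open>d\<close> says that the leading 2 by 2 block of the identity plus
  \<open>mat_diag n d\<close> times the rotation has determinant zero; the congruences by
  \<open>R\<close> and \<open>R'\<close> cancel.\<close>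

lemma rotation_congruence_singular:
  fixes R R' :: "real mat" and d :: "nat \<Rightarrow> complex"
  assumes n: "n \<ge> 2"
    and R: "R \<in> carrier_mat n n" "R' \<in> carrier_mat n n" "R * R' = 1\<^sub>m n"
    and M: "M = transpose_mat (complex_mat R) * mat_diag n d * complex_mat R"
    and d: "1 + d 0 * d 1 + complex_of_real (cos \<theta>) * (d 0 + d 1) = 0" "d 0 \<noteq> 0" and \<theta>: "sin \<theta> \<noteq> 0"
  shows "det (1\<^sub>m n + M * complex_mat (R' * rotation_block n \<theta> * transpose_mat R')) = 0"
proof -
  define D where "D = mat_diag n d"
  define G where "G = complex_mat (rotation_block n \<theta>)"
  define S where "S = complex_mat R"
  define S' where "S' = complex_mat R'"
  have c: "D \<in> carrier_mat n n" "G \<in> carrier_mat n n" "S \<in> carrier_mat n n" "S' \<in> carrier_mat n n"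
    using R by (auto simp: D_def G_def S_def S'_def rotation_block_def)
  have ct: "transpose_mat S \<in> carrier_mat n n" "transpose_mat S' \<in> carrier_mat n n" using c by auto
  have SS: "S * S' = 1\<^sub>m n"
    using complex_mat_mult[OF R(1,2)] R(3) by (simp add: S_def S'_def of_real_hom.mat_hom_one)
  have SSt: "transpose_mat S' * transpose_mat S = 1\<^sub>m n"
    using transpose_mult[OF c(3,4)] SS by simp
  have \<Delta>: "complex_mat (R' * rotation_block n \<theta> * transpose_mat R') = S' * G * transpose_mat S'" (is "?\<Delta> = _")
  proof -
    have 1: "rotation_block n \<theta> \<in> carrier_mat n n" by (simp add: rotation_block_def)
    have 2: "transpose_mat S' = complex_mat (transpose_mat R')" unfolding S'_def by auto
    show ?thesis unfolding 2 unfolding S'_def G_def using R 1 by (simp add: complex_mat_mult[of _ n n _ n])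
  qed
  \<comment> \<open>This solves the first row of the singular block; the second row then vanishes by
    the equation on \<open>d\<close>. The entry \<open>d 0 * sin \<theta>\<close> shows that the
    vector is nonzero.\<close>
  define v where "v = vec n (\<lambda>i. if i = 0 then d 0 * sin \<theta> else if i = 1 then 1 + d 0 * cos \<theta> else 0)"
  have v: "v \<in> carrier_vec n" by (simp add: v_def)
  have sum2: "(\<Sum>j\<in>{0..<n}. f j * v $ j) = f 0 * v $ 0 + f 1 * v $ 1" for f :: "nat \<Rightarrow> complex"
  proof -
    have "(\<Sum>j\<in>{0..<n}. f j * v $ j) = (\<Sum>j\<in>{0,1}. f j * v $ j)"
      using n by (intro sum.mono_neutral_right) (auto simp: v_def)
    thus ?thesis by simp
  qed
  have DGv: "D *\<^sub>v (G *\<^sub>v v) = - v"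
  proof (rule eq_vecI)
    fix i assume "i < dim_vec (- v)"
    hence i: "i < n" using v by simp
    have "(G *\<^sub>v v) $ i = (\<Sum>j\<in>{0..<n}. rotation_block n \<theta> $$ (i,j) * v $ j)"
      using c v i by (auto simp: scalar_prod_def G_def intro!: sum.cong)
    also have "\<dots> = rotation_block n \<theta> $$ (i,0) * v $ 0 + rotation_block n \<theta> $$ (i,1) * v $ 1"
      by (rule sum2)
    finally have Gv: "(G *\<^sub>v v) $ i = \<dots>" .
    have "(D *\<^sub>v (G *\<^sub>v v)) $ i = d i * (G *\<^sub>v v) $ i"
      unfolding D_def using c v i by (subst mat_diag_mult_vec) auto
    also have "\<dots> = - v $ i"
    proof -
      consider "i = 0" | "i = 1" | "i \<ge> 2" by linarith
      thus ?thesis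
      proof cases
        case 1
        thus ?thesis unfolding Gv using n by (simp add: rotation_block_def v_def algebra_simps)
      next
        case 2
        have "d 1 * (a * (d 0 * a) + b * (1 + d 0 * b)) = d 0 * d 1 * (a * a + b * b) + b * d 1" for a b
          by (simp add: algebra_simps)
        moreover have "complex_of_real (sin \<theta>) * sin \<theta> + complex_of_real (cos \<theta>) * cos \<theta> = 1"
          using sin_cos_squared_add3[of \<theta>] by (simp add: add.commute flip: of_real_mult of_real_add)
        ultimately have "d 1 * (sin \<theta> * (d 0 * sin \<theta>) + cos \<theta> * (1 + d 0 * cos \<theta>)) =
            d 0 * d 1 + cos \<theta> * d 1" by simp
        also have "\<dots> = - (1 + d 0 * cos \<theta>)"
          using d(1) by (simp add: algebra_simps eq_neg_iff_add_eq_0)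
        finally show ?thesis using 2 n unfolding Gv by (simp add: rotation_block_def v_def)
      next
        case 3
        thus ?thesis unfolding Gv using i by (simp add: rotation_block_def v_def)
      qed
    qed
    finally show "(D *\<^sub>v (G *\<^sub>v v)) $ i = (- v) $ i" using i v by simp
  qed (use c v in auto)
  define z where "z = transpose_mat S *\<^sub>v v"
  have z: "z \<in> carrier_vec n" using ct v by (auto simp: z_def)
  have Sz: "transpose_mat S' *\<^sub>v z = v"
    unfolding z_def using ct v SSt by (subst assoc_mult_mat_vec[symmetric, of _ n n _ n]) auto
  have "z \<noteq> 0\<^sub>v n"
  proof
    assume "z = 0\<^sub>v n"
    hence "v = 0\<^sub>v n" using Sz ct by auto
    hence "v $ 0 = 0" using n by simp
    thus False using n d(2) \<theta> by (simp add: v_def)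
  qed
  moreover have "(1\<^sub>m n + M * ?\<Delta>) *\<^sub>v z = 0\<^sub>v n"
  proof -
    have Mc: "M = transpose_mat S * D * S" using M by (simp add: S_def D_def)
    have Mcar: "M \<in> carrier_mat n n" unfolding Mc using c ct by auto
    have Dc: "S' * G * transpose_mat S' \<in> carrier_mat n n" using c ct by auto
    have "M * (S' * G * transpose_mat S') *\<^sub>v z = transpose_mat S * (D * ((S * S') * (G * transpose_mat S'))) *\<^sub>v z"
      unfolding Mc using c ct by (simp add: assoc_mult_mat[of _ n n _ n _ n])
    also have "\<dots> = transpose_mat S *\<^sub>v (D *\<^sub>v (G *\<^sub>v (transpose_mat S' *\<^sub>v z)))"
      unfolding SS using c ct z by (simp add: assoc_mult_mat_vec[of _ n n _ n])
    also have "\<dots> = transpose_mat S *\<^sub>v (- v)" unfolding Sz DGv ..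
    also have "\<dots> = - z" unfolding z_def using ct v by (intro eq_vecI) auto
    finally show ?thesis
      unfolding \<Delta> using Mcar Dc z by (simp add: add_mult_distrib_mat_vec[of _ n n])
  qed
  moreover have "1\<^sub>m n + M * ?\<Delta> \<in> carrier_mat n n"
    unfolding \<Delta> M using R c ct by auto
  ultimately show ?thesis using z det_0_iff_vec_prod_zero_field by blast
qed

section \<open>The stability radius\<close>

lemma Re_Im_weighted_phases:
  "Re (- (\<Sum>k<n. cnj (cis (f k)) * complex_of_real (r k))) = - (\<Sum>k<n. cos (f k) * r k)"
  "Im (- (\<Sum>k<n. cnj (cis (f k)) * complex_of_real (r k))) = (\<Sum>k<n. sin (f k) * r k)"
  by (simp_all add: sum_negf)

context phase_tuple
begin

text \<open>A kernel vector would give the cycle \<open>cmod q \<le> Re p\<close>,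
  \<open>Re p\<close> strictly below the difference of weights, and that difference at most
  \<open>cmod q\<close>.\<close>

lemma no_singular_perturbation:
  fixes \<Delta> R :: "real mat"
  assumes R: "R \<in> carrier_mat n n"
    and M: "M = transpose_mat (complex_mat R) * mat_diag n (\<lambda>i. cis (\<mu> (Suc i))) * complex_mat R"
    and \<Delta>: "\<Delta> \<in> carrier_mat n n"
    and pos: "\<And>x. x \<in> carrier_vec n \<Longrightarrow> x \<noteq> 0\<^sub>v n \<Longrightarrow> 0 < (\<Delta> *\<^sub>v x) \<bullet> x"
    and sum: "\<mu> 1 + \<mu> 2 \<le> pi"
  shows "det (1\<^sub>m n + M * complex_mat \<Delta>) \<noteq> 0"
proof
  assume sing: "det (1\<^sub>m n + M * complex_mat \<Delta>) = 0"
  have c\<Delta>: "complex_mat \<Delta> \<in> carrier_mat n n" using \<Delta> by auto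
  obtain z w where z: "z \<in> carrier_vec n" "z \<noteq> 0\<^sub>v n"
    and p: "(complex_mat \<Delta> *\<^sub>v z) \<bullet>c z =
      - (\<Sum>k<n. cnj (cis (\<mu> (Suc k))) * of_real ((cmod (w k))\<^sup>2))"
    and q: "(complex_mat \<Delta> *\<^sub>v z) \<bullet> z = - (\<Sum>k<n. cis (\<mu> (Suc k)) * (w k)\<^sup>2)"
    using singular_congruent_diagonal_forms[OF R c\<Delta> M sing] by blast
  have cpos: "0 < Re ((complex_mat \<Delta> *\<^sub>v x) \<bullet>c x)" if "x \<in> carrier_vec n" "x \<noteq> 0\<^sub>v n" for x
    using complex_form_Re_pos[OF \<Delta> that pos] .
  have cnonneg: "0 \<le> Re ((complex_mat \<Delta> *\<^sub>v x) \<bullet>c x)" if "x \<in> carrier_vec n" for x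
    using cpos[OF that] that c\<Delta> by (cases "x = 0\<^sub>v n") auto
  have "cmod (\<Sum>k<n. cis (\<mu> (Suc k)) * (w k)\<^sup>2) \<le> - (\<Sum>k<n. cos (\<mu> (Suc k)) * (cmod (w k))\<^sup>2)"
    using real_matrix_form_bounds(1)[OF \<Delta> z(1) cnonneg]
    unfolding p q Re_Im_weighted_phases norm_minus_cancel by simp
  also have "\<dots> < (cmod (w 0))\<^sup>2 - (\<Sum>k\<in>{1..<n}. (cmod (w k))\<^sup>2)"
    using cpos[OF z] unfolding p Re_Im_weighted_phases
    by (intro cosine_sum_bound) (use sum in auto)
  also have "\<dots> \<le> cmod (\<Sum>k<n. cis (\<mu> (Suc k)) * (w k)\<^sup>2)"
    using n by (intro cmod_sum_squares_ge) auto
  finally show False by simp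
qed

text \<open>The forms at a kernel vector meet the hypotheses of
  \<open>tangent_bound_of_forms\<close> with \<open>S = sin \<delta>\<close>; in terms of cosines
  its conclusion reads \<open>cos \<delta> * cos (\<phi> 1) \<le> - cos \<sigma>\<close>.\<close>

lemma largest_phase_ge:
  fixes \<Delta> R :: "real mat"
  assumes R: "R \<in> carrier_mat n n"
    and M: "M = transpose_mat (complex_mat R) * mat_diag n (\<lambda>i. cis (\<mu> (Suc i))) * complex_mat R"
    and \<Delta>: "\<Delta> \<in> carrier_mat n n"
    and sec: "sectorial_with_phases n (complex_mat \<Delta>) \<phi>"
    and \<phi>: "\<And>i. i \<in> {1..n} \<Longrightarrow> \<phi> i \<in> {- pi / 2 <..< pi / 2}"
    and sing: "det (1\<^sub>m n + M * complex_mat \<Delta>) = 0"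
    and sum: "pi < \<mu> 1 + \<mu> 2"
  shows "arccos (- (cos ((\<mu> 1 + \<mu> 2) / 2) / cos ((\<mu> 1 - \<mu> 2) / 2))) \<le> \<phi> 1"
proof -
  define \<sigma> where "\<sigma> = (\<mu> 1 + \<mu> 2) / 2"
  define \<delta> where "\<delta> = (\<mu> 1 - \<mu> 2) / 2"
  define \<tau> where "\<tau> = tan (\<phi> 1)"
  have \<delta>: "0 \<le> \<delta>" "\<delta> < pi / 2"
    using second_phase_bounds by (auto simp: \<delta>_def)
  have \<sigma>: "pi / 2 < \<sigma>" "\<sigma> < pi"
    using second_phase_bounds sum upper by (auto simp: \<sigma>_def)
  have \<sigma>\<delta>: "\<sigma> + \<delta> = \<mu> 1" by (simp add: \<sigma>_def \<delta>_def field_simps)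
  have c\<Delta>: "complex_mat \<Delta> \<in> carrier_mat n n" using \<Delta> by auto
  obtain z w where z: "z \<in> carrier_vec n" "z \<noteq> 0\<^sub>v n"
    and p: "(complex_mat \<Delta> *\<^sub>v z) \<bullet>c z =
      - (\<Sum>k<n. cnj (cis (\<mu> (Suc k))) * of_real ((cmod (w k))\<^sup>2))"
    and q: "(complex_mat \<Delta> *\<^sub>v z) \<bullet> z = - (\<Sum>k<n. cis (\<mu> (Suc k)) * (w k)\<^sup>2)"
    using singular_congruent_diagonal_forms[OF R c\<Delta> M sing] by blast
  define P where "P = - (\<Sum>k<n. cos (\<mu> (Suc k)) * (cmod (w k))\<^sup>2)"
  define I where "I = (\<Sum>k<n. sin (\<mu> (Suc k)) * (cmod (w k))\<^sup>2)"
  define Q where "Q = cmod (\<Sum>k<n. cis (\<mu> (Suc k)) * (w k)\<^sup>2)"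
  have cnonneg: "0 \<le> Re ((complex_mat \<Delta> *\<^sub>v x) \<bullet>c x)" if "x \<in> carrier_vec n" for x
    using sectorial_form(1)[OF sec \<phi> that] that c\<Delta> by (cases "x = 0\<^sub>v n") auto
  have P0: "0 < P"
    using sectorial_form(1)[OF sec \<phi> z] unfolding p Re_Im_weighted_phases P_def .
  have QP: "Q \<le> P"
    using real_matrix_form_bounds(1)[OF \<Delta> z(1) cnonneg]
    unfolding p q Re_Im_weighted_phases norm_minus_cancel P_def Q_def .
  have "\<bar>I\<bar> \<le> \<tau> * P \<and> I\<^sup>2 + (\<tau> * Q)\<^sup>2 \<le> (\<tau> * P)\<^sup>2"
    using real_matrix_form_bounds(2)[OF \<Delta> z(1) cnonneg sectorial_form(2)[OF sec \<phi>]]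
    unfolding p q Re_Im_weighted_phases norm_minus_cancel P_def Q_def I_def \<tau>_def .
  hence disc: "I\<^sup>2 + (\<tau> * Q)\<^sup>2 \<le> (\<tau> * P)\<^sup>2" and "0 \<le> \<tau> * P" by auto
  hence \<tau>: "0 \<le> \<tau>" using P0 by (simp add: zero_le_mult_iff)
  \<comment> \<open>The addition theorem combines the cosines and sines of the phases into sines of
    the phases shifted by \<open>\<sigma>\<close>, to which \<open>sine_sum_bound\<close>
    applies.\<close>
  have "P * sin \<sigma> + I * cos \<sigma> = (\<Sum>k<n. sin (\<mu> (Suc k) - \<sigma>) * (cmod (w k))\<^sup>2)"
    unfolding P_def I_def sum_negf[symmetric] sum_distrib_right sum.distrib[symmetric]
    by (intro sum.cong) (auto simp: sin_diff algebra_simps)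
  also have "\<dots> \<le> sin \<delta> * ((cmod (w 0))\<^sup>2 - (\<Sum>k\<in>{1..<n}. (cmod (w k))\<^sup>2))"
    unfolding \<sigma>_def \<delta>_def by (intro sine_sum_bound) auto
  also have "\<dots> \<le> sin \<delta> * Q"
    unfolding Q_def using n \<delta> by (intro mult_left_mono cmod_sum_squares_ge sin_ge_zero) auto
  finally have lin: "P * sin \<sigma> + I * cos \<sigma> \<le> sin \<delta> * Q" .
  have "(sin \<sigma>)\<^sup>2 - (sin \<delta>)\<^sup>2 \<le> (cos \<sigma>)\<^sup>2 * \<tau>\<^sup>2"
    using P0 QP \<tau> disc lin \<sigma> \<delta>
    by (intro tangent_bound_of_forms[of P Q \<tau> I]) (auto simp: Q_def intro!: sin_ge_zero)
  hence "(cos \<delta>)\<^sup>2 \<le> (cos \<sigma>)\<^sup>2 * (1 + \<tau>\<^sup>2)"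
    unfolding sin_squared_eq by (simp add: distrib_left)
  moreover have \<phi>1: "- pi / 2 < \<phi> 1" "\<phi> 1 < pi / 2" using \<phi>[of 1] n by auto
  have cos\<phi>: "0 < cos (\<phi> 1)" using \<phi>1 by (intro cos_gt_zero_pi) auto
  hence "1 + \<tau>\<^sup>2 = 1 / (cos (\<phi> 1))\<^sup>2"
    using tan_sec[of "\<phi> 1"] by (simp add: \<tau>_def inverse_eq_divide power_divide)
  ultimately have "(cos \<delta>)\<^sup>2 \<le> (cos \<sigma>)\<^sup>2 / (cos (\<phi> 1))\<^sup>2" by simp
  hence "(cos \<delta>)\<^sup>2 * (cos (\<phi> 1))\<^sup>2 \<le> (cos \<sigma>)\<^sup>2"
    using cos\<phi> by (subst (asm) pos_le_divide_eq) auto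
  hence "(cos \<delta> * cos (\<phi> 1))\<^sup>2 \<le> (- cos \<sigma>)\<^sup>2" by (simp add: power_mult_distrib)
  moreover have cos\<sigma>: "cos \<sigma> < 0"
    using cos_monotone_0_pi[of "pi / 2" \<sigma>] \<sigma> by simp
  ultimately have le: "cos \<delta> * cos (\<phi> 1) \<le> - cos \<sigma>"
    using power2_le_imp_le[of "cos \<delta> * cos (\<phi> 1)" "- cos \<sigma>"] by linarith
  have cos\<delta>: "0 < cos \<delta>" using \<delta> by (intro cos_gt_zero_pi; linarith)
  \<comment> \<open>Since \<open>\<sigma> + \<delta> = \<mu> 1 < pi\<close>, the quotient is at most
    1 and thus in the domain of \<open>arccos\<close>.\<close>
  have "cos (pi - \<delta>) \<le> cos \<sigma>"
    using \<delta> \<sigma> \<sigma>\<delta> upper by (intro cos_monotone_0_pi_le; linarith)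
  hence 1: "- cos \<sigma> / cos \<delta> \<le> 1" using cos\<delta> by (subst pos_divide_le_eq) auto
  have 2: "cos (\<phi> 1) \<le> - cos \<sigma> / cos \<delta>"
    using le cos\<delta> by (subst pos_le_divide_eq) (auto simp: mult.commute)
  have "arccos (- cos \<sigma> / cos \<delta>) \<le> arccos (cos (\<phi> 1))"
    by (rule arccos_le_arccos[OF cos_ge_minus_one 2 1])
  also have "arccos (cos (\<phi> 1)) = \<phi> 1"
  proof (rule arccos_cos)
    \<comment> \<open>\<open>arccos\<close> inverts \<open>cos\<close> only on nonnegative angles;
      the sign of \<open>\<phi> 1\<close> is read off from \<open>\<tau> \<ge> 0\<close>.\<close>
    show "0 \<le> \<phi> 1"
    proof (rule ccontr)
      assume "\<not> 0 \<le> \<phi> 1"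
      hence "tan (\<phi> 1) < tan 0" using \<phi>1 by (intro tan_monotone) auto
      with \<tau> show False by (simp add: \<tau>_def)
    qed
  qed (use \<phi>1 in auto)
  finally show ?thesis by (simp add: \<sigma>_def \<delta>_def)
qed

text \<open>The rotation angle \<open>\<theta>\<close> is chosen so that
  \<open>cos \<sigma> + cos \<theta> * cos \<delta> = 0\<close>, which is the singularity condition
  of \<open>rotation_congruence_singular\<close> for the first two phases.\<close>

lemma optimal_perturbation:
  fixes R R' :: "real mat"
  assumes R: "R \<in> carrier_mat n n" "R' \<in> carrier_mat n n" "R * R' = 1\<^sub>m n"
    and M: "M = transpose_mat (complex_mat R) * mat_diag n (\<lambda>i. cis (\<mu> (Suc i))) * complex_mat R"
    and sum: "pi < \<mu> 1 + \<mu> 2"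
  obtains \<Delta> :: "real mat" and \<phi> where "\<Delta> \<in> carrier_mat n n"
    "sectorial_with_phases n (complex_mat \<Delta>) \<phi>"
    "\<forall>i \<in> {1..n}. \<phi> i \<in> {- pi / 2 <..< pi / 2}"
    "det (1\<^sub>m n + M * complex_mat \<Delta>) = 0"
    "\<phi> 1 = arccos (- (cos ((\<mu> 1 + \<mu> 2) / 2) / cos ((\<mu> 1 - \<mu> 2) / 2)))"
proof -
  define \<sigma> where "\<sigma> = (\<mu> 1 + \<mu> 2) / 2"
  define \<delta> where "\<delta> = (\<mu> 1 - \<mu> 2) / 2"
  define \<theta> where "\<theta> = arccos (- (cos \<sigma> / cos \<delta>))"
  have \<delta>: "0 \<le> \<delta>" "\<delta> < pi / 2"
    using second_phase_bounds by (auto simp: \<delta>_def)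
  have \<sigma>: "pi / 2 < \<sigma>" "\<sigma> < pi"
    using second_phase_bounds sum upper by (auto simp: \<sigma>_def)
  have \<sigma>\<delta>: "\<sigma> + \<delta> = \<mu> 1" by (simp add: \<sigma>_def \<delta>_def field_simps)
  have cos\<sigma>: "cos \<sigma> < 0" using cos_monotone_0_pi[of "pi / 2" \<sigma>] \<sigma> by simp
  have cos\<delta>: "0 < cos \<delta>" using \<delta> by (intro cos_gt_zero_pi; linarith)
  have "cos (pi - \<delta>) < cos \<sigma>"
    using \<delta> \<sigma> \<sigma>\<delta> upper by (intro cos_monotone_0_pi; linarith)
  \<comment> \<open>Both bounds are strict: the lower one keeps \<open>\<theta>\<close> below
    \<open>pi / 2\<close>, and the upper one makes \<open>\<theta>\<close> positive, so that
    \<open>sin \<theta>\<close> is nonzero.\<close>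
  hence X: "0 < - (cos \<sigma> / cos \<delta>)" "- (cos \<sigma> / cos \<delta>) < 1" using cos\<delta> cos\<sigma> by (auto simp: field_simps)
  hence cos\<theta>: "cos \<theta> = - (cos \<sigma> / cos \<delta>)" unfolding \<theta>_def by (intro cos_arccos) auto
  have \<theta>0: "0 < \<theta>" using arccos_lt_bounded[of "- (cos \<sigma> / cos \<delta>)"] X by (auto simp: \<theta>_def)
  have \<theta>1: "\<theta> < pi / 2"
    using arccos_less_arccos[of 0 "- (cos \<sigma> / cos \<delta>)"] X by (auto simp: \<theta>_def)
  have e: "cis (\<mu> 1) = cis \<sigma> * cis \<delta>" "cis (\<mu> 2) = cis \<sigma> * cis (- \<delta>)"
    unfolding cis_mult by (simp_all add: \<sigma>_def \<delta>_def field_simps)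
  \<comment> \<open>Pulling out \<open>cis \<sigma>\<close> symmetrizes the exponents, and the
    remaining factor is the real number
    \<open>2 * (cos \<sigma> + cos \<theta> * cos \<delta>)\<close>.\<close>
  have "1 + cis (\<mu> 1) * cis (\<mu> 2) + complex_of_real (cos \<theta>) * (cis (\<mu> 1) + cis (\<mu> 2)) =
      cis \<sigma> * ((cis \<sigma> + cis (- \<sigma>)) + cos \<theta> * (cis \<delta> + cis (- \<delta>)))"
  proof -
    have "cis \<sigma> * cis (- \<sigma>) = 1" "cis \<delta> * cis (- \<delta>) = 1" unfolding cis_mult by simp_all
    moreover have "1 + a * b * (a * b') + c * (a * b + a * b') = a * ((a + a') + c * (b + b'))"
      if "a * a' = 1" "b * b' = 1" for a a' b b' c :: complex
    proof -
      have "a * b * (a * b') = a * a * (b * b')" by (simp add: mult_ac)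
      thus ?thesis using that by (simp add: algebra_simps)
    qed
    ultimately show ?thesis unfolding e by blast
  qed
  also have "(cis \<sigma> + cis (- \<sigma>)) + cos \<theta> * (cis \<delta> + cis (- \<delta>)) = of_real (2 * cos \<sigma> + cos \<theta> * (2 * cos \<delta>))"
    by (simp add: complex_eq_iff)
  also have "2 * cos \<sigma> + cos \<theta> * (2 * cos \<delta>) = 0"
    unfolding cos\<theta> using cos\<delta> by simp
  finally have eq: "1 + cis (\<mu> 1) * cis (\<mu> 2) + complex_of_real (cos \<theta>) * (cis (\<mu> 1) + cis (\<mu> 2)) = 0"
    by simp
  define \<Delta> where "\<Delta> = R' * rotation_block n \<theta> * transpose_mat R'"
  have "\<Delta> \<in> carrier_mat n n" unfolding \<Delta>_def using R by (auto simp: rotation_block_def)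
  moreover have "sectorial_with_phases n (complex_mat \<Delta>) (rotation_phases n \<theta>)"
    unfolding \<Delta>_def using \<theta>0 \<theta>1 by (intro rotation_congruence_sectorial[OF n _ _ R]) auto
  moreover have "\<forall>i \<in> {1..n}. rotation_phases n \<theta> i \<in> {- pi / 2 <..< pi / 2}"
    using \<theta>0 \<theta>1 by (auto simp: rotation_phases_def)
  moreover have "det (1\<^sub>m n + M * complex_mat \<Delta>) = 0"
    unfolding \<Delta>_def
  proof (rule rotation_congruence_singular[OF n R M])
    show "sin \<theta> \<noteq> 0" using sin_gt_zero[of \<theta>] \<theta>0 \<theta>1 by auto
  qed (use eq in \<open>auto simp: numeral_2_eq_2\<close>)
  moreover have "rotation_phases n \<theta> 1 = arccos (- (cos ((\<mu> 1 + \<mu> 2) / 2) / cos ((\<mu> 1 - \<mu> 2) / 2)))"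
    by (simp add: rotation_phases_def \<theta>_def \<sigma>_def \<delta>_def)
  ultimately show thesis using that by blast
qed

end

theorem corollary3p6:
  fixes n :: nat and M :: "complex mat" and \<mu> :: "nat \<Rightarrow> real"
  assumes "n \<ge> 2"
    and "M \<in> carrier_mat n n"
    and "transpose_mat M = M"
    and "sectorial_with_phases n M \<mu>"
    and "\<mu> 1 < pi" and "\<mu> n > - pi / 2"
  shows "(\<mu> 1 + \<mu> 2 \<le> pi \<longrightarrow>
      \<not> (\<exists>\<Delta> \<in> carrier_mat n n. positive_definite (\<Delta> + transpose_mat \<Delta>) \<and>
            det (1\<^sub>m n + M * complex_mat \<Delta>) = 0) \<and>
      real_angular_stability_radius n M = \<infinity>) \<and>
    (\<mu> 1 + \<mu> 2 > pi \<longrightarrow>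
      real_angular_stability_radius n M =
        ereal (arccos (- (cos ((\<mu> 1 + \<mu> 2) / 2) / cos ((\<mu> 1 - \<mu> 2) / 2)))))"
proof (intro conjI impI)
  interpret phase_tuple n \<mu>
    using assms by unfold_locales (auto simp: sectorial_with_phases_def)
  have "n \<noteq> 0" using n by simp
  then obtain R R' :: "real mat" where R: "R \<in> carrier_mat n n" "R' \<in> carrier_mat n n" "R * R' = 1\<^sub>m n"
    and M: "M = transpose_mat (complex_mat R) * mat_diag n (\<lambda>i. cis (\<mu> (Suc i))) * complex_mat R"
    using sectorial_symmetric_real_congruence[OF assms(2-4)] by blast
  {
    assume sum: "\<mu> 1 + \<mu> 2 \<le> pi"
    note none = no_singular_perturbation[OF R(1) M _ _ sum]
    show "\<not> (\<exists>\<Delta> \<in> carrier_mat n n. positive_definite (\<Delta> + transpose_mat \<Delta>) \<and>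
        det (1\<^sub>m n + M * complex_mat \<Delta>) = 0)"
      using none by (auto simp: positive_definite_symmetric_part_iff)
    have empty: "{ereal (\<phi> 1) | \<phi> \<Delta>.
        \<Delta> \<in> carrier_mat n n \<and> positive_definite (hermitian_part \<Delta>) \<and>
        sectorial_with_phases n (complex_mat \<Delta>) \<phi> \<and>
        (\<forall>i \<in> {1..n}. \<phi> i \<in> {- pi / 2 <..< pi / 2}) \<and>
        det (1\<^sub>m n + M * complex_mat \<Delta>) = 0} = {}"
      using none by (auto simp: positive_definite_hermitian_part_iff)
    show "real_angular_stability_radius n M = \<infinity>"
      unfolding real_angular_stability_radius_def empty by (simp add: top_ereal_def)
  next
    assume sum: "\<mu> 1 + \<mu> 2 > pi"
    obtain \<Delta> :: "real mat" and \<phi> where \<Delta>: "\<Delta> \<in> carrier_mat n n"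
      "sectorial_with_phases n (complex_mat \<Delta>) \<phi>"
      "\<forall>i \<in> {1..n}. \<phi> i \<in> {- pi / 2 <..< pi / 2}"
      "det (1\<^sub>m n + M * complex_mat \<Delta>) = 0"
      and \<phi>: "\<phi> 1 = arccos (- (cos ((\<mu> 1 + \<mu> 2) / 2) / cos ((\<mu> 1 - \<mu> 2) / 2)))"
      using optimal_perturbation[OF R M sum] .
    have pd: "positive_definite (hermitian_part \<Delta>)"
      using sectorial_imp_positive_definite[OF \<Delta>(1,2)] \<Delta>(3) by blast
    \<comment> \<open>The infimum is a minimum: case 1 bounds every admissible largest phase from
      below, and case 2 holds because the optimal \<open>\<Delta>\<close> is itself
      admissible.\<close>
    show "real_angular_stability_radius n M =
        ereal (arccos (- (cos ((\<mu> 1 + \<mu> 2) / 2) / cos ((\<mu> 1 - \<mu> 2) / 2))))"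
      unfolding real_angular_stability_radius_def \<phi>[symmetric]
    proof (rule Inf_eqI, goal_cases)
      case (1 x)
      then obtain \<phi>' \<Delta>' where "x = ereal (\<phi>' 1)" "\<Delta>' \<in> carrier_mat n n"
        "sectorial_with_phases n (complex_mat \<Delta>') \<phi>'"
        "\<forall>i \<in> {1..n}. \<phi>' i \<in> {- pi / 2 <..< pi / 2}"
        "det (1\<^sub>m n + M * complex_mat \<Delta>') = 0" by blast
      thus ?case
        using largest_phase_ge[OF R(1) M _ _ _ _ sum, of \<Delta>' \<phi>'] unfolding \<phi> by simp
    next
      case (2 y)
      show ?case by (rule 2) (use \<Delta> pd in blast)
    qed
  }
qed

end
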